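(* If $L_1$ and $L_2$ are (disjoint) Tr-lattices, then $L_1*L_2$ is a Tr-lattice.
   Context: All matroids and lattices are finite. A flat $X$ of a matroid $M$ is cyclic if $M|X$ has no isthmuses; the cyclic flats ordered by inclusion form a lattice $\mathcal{Z}(M)$. A lattice $L$ is a Tr-lattice if every matroid $M$ with $\mathcal{Z}(M)$ isomorphic to $L$ is transversal. For disjoint lattices $L_1,L_2$ with greatest elements $\hat{1}_{L_1},\hat{1}_{L_2}$, the lattice $L_1*L_2$ has underlying set $(L_1\cup L_2\cup\{\hat{0},\hat{1}\})-\{\hat{1}_{L_1},\hat{1}_{L_2}\}$, where $\hat 0,\hat 1$ are two new elements, and $x\le y$ if and only if (i) $y=\hat{1}$, or (ii) $x=\hat{0}$, or (iii) for some $i\in\{1,2\}$, both $x,y\in L_i$ and $x\le y$ in $L_i$. *)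

theory Defs
  imports "HOL-Algebra.Lattice"
begin

section \<open>Finite matroids\<close>

locale matroid =
  fixes E :: "'e set" and indep :: "'e set \<Rightarrow> bool"
  assumes finite_ground: "finite E"
    and indep_subset_ground: "indep X \<Longrightarrow> X \<subseteq> E"
    and indep_empty: "indep {}"
    and indep_subset: "\<lbrakk>indep X; Y \<subseteq> X\<rbrakk> \<Longrightarrow> indep Y"
    and augment: "\<lbrakk>indep X; indep Y; card X = card Y + 1\<rbrakk> \<Longrightarrow> \<exists>x\<in>X - Y. indep (insert x Y)"

definition matroid_basis :: "('e set \<Rightarrow> bool) \<Rightarrow> 'e set \<Rightarrow> bool" where
  "matroid_basis indep B \<longleftrightarrow> indep B \<and> (\<forall>X. indep X \<longrightarrow> B \<subseteq> X \<longrightarrow> X = B)"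

definition isthmus :: "'e set \<Rightarrow> ('e set \<Rightarrow> bool) \<Rightarrow> 'e \<Rightarrow> bool" where
  "isthmus E indep e \<longleftrightarrow> e \<in> E \<and> (\<forall>B. matroid_basis indep B \<longrightarrow> e \<in> B)"

definition restrict_indep :: "('e set \<Rightarrow> bool) \<Rightarrow> 'e set \<Rightarrow> 'e set \<Rightarrow> bool" where
  "restrict_indep indep X Y \<longleftrightarrow> Y \<subseteq> X \<and> indep Y"

definition matroid_rank :: "('e set \<Rightarrow> bool) \<Rightarrow> 'e set \<Rightarrow> nat" where
  "matroid_rank indep X = Max (card ` {Y. Y \<subseteq> X \<and> indep Y})"

definition flat :: "'e set \<Rightarrow> ('e set \<Rightarrow> bool) \<Rightarrow> 'e set \<Rightarrow> bool" where
  "flat E indep X \<longleftrightarrow>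
     X \<subseteq> E \<and> (\<forall>e\<in>E - X. matroid_rank indep (insert e X) > matroid_rank indep X)"

definition cyclic_flat :: "'e set \<Rightarrow> ('e set \<Rightarrow> bool) \<Rightarrow> 'e set \<Rightarrow> bool" where
  "cyclic_flat E indep X \<longleftrightarrow>
     flat E indep X \<and> \<not> (\<exists>e. isthmus X (restrict_indep indep X) e)"

definition cyclic_flats :: "'e set \<Rightarrow> ('e set \<Rightarrow> bool) \<Rightarrow> 'e set gorder" where
  "cyclic_flats E indep =
     \<lparr>carrier = {X. cyclic_flat E indep X}, eq = (=), le = (\<subseteq>)\<rparr>"

text \<open>The independent sets are the partial transversals of a finite family
  \<^term>\<open>A 0\<close>, ..., \<^term>\<open>A (r - 1)\<close> of subsets of the ground set; repetitions are allowed.\<close>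

definition transversal_matroid :: "'e set \<Rightarrow> ('e set \<Rightarrow> bool) \<Rightarrow> bool" where
  "transversal_matroid E indep \<longleftrightarrow> matroid E indep \<and>
     (\<exists>(r::nat) A. (\<forall>j<r. A j \<subseteq> E) \<and>
        (\<forall>X. indep X \<longleftrightarrow>
           X \<subseteq> E \<and> (\<exists>\<phi>. inj_on \<phi> X \<and> (\<forall>x\<in>X. \<phi> x < r \<and> x \<in> A (\<phi> x)))))"

section \<open>Lattices\<close>

definition finite_lattice :: "'a gorder \<Rightarrow> bool" where
  "finite_lattice L \<longleftrightarrow> lattice L \<and> finite (carrier L) \<and> carrier L \<noteq> {}"

definition order_isomorphic :: "'a gorder \<Rightarrow> 'b gorder \<Rightarrow> bool" where
  "order_isomorphic A B \<longleftrightarrow>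
     (\<exists>f. order_emb A B f \<and> bij_betw f (carrier A) (carrier B))"

text \<open>HOL cannot quantify over all types inside a definition, so the ground sets range over finite
  sets of natural numbers. Every finite matroid is isomorphic to one of these, and the lemma
  \<open>Tr_lattice_transversal\<close> below gives the property for ground sets in an arbitrary type.\<close>

definition Tr_lattice :: "'a gorder \<Rightarrow> bool" where
  "Tr_lattice L \<longleftrightarrow> finite_lattice L \<and>
     (\<forall>(E :: nat set) indep. matroid E indep \<longrightarrow> order_isomorphic (cyclic_flats E indep) L \<longrightarrow>
        transversal_matroid E indep)"

text \<open>The parameters \<^term>\<open>z\<close> and \<^term>\<open>t\<close> are the new least and greatest elements; they are meant
  to be distinct and outside both carriers.\<close>

definition lattice_star :: "'a \<Rightarrow> 'a \<Rightarrow> 'a gorder \<Rightarrow> 'a gorder \<Rightarrow> 'a gorder" where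
  "lattice_star z t L1 L2 =
     \<lparr>carrier = (carrier L1 \<union> carrier L2 \<union> {z, t}) - {\<top>\<^bsub>L1\<^esub>, \<top>\<^bsub>L2\<^esub>},
      eq = (=),
      le = (\<lambda>x y. y = t \<or> x = z \<or>
              (x \<in> carrier L1 \<and> y \<in> carrier L1 \<and> x \<sqsubseteq>\<^bsub>L1\<^esub> y) \<or>
              (x \<in> carrier L2 \<and> y \<in> carrier L2 \<and> x \<sqsubseteq>\<^bsub>L2\<^esub> y))\<rparr>"

section \<open>Independence of the type of the ground set\<close>

locale matroid_copy = matroid E indep for E :: "'e set" and indep +
  fixes f :: "'e \<Rightarrow> 'f" and indep' :: "'f set \<Rightarrow> bool"
  assumes inj: "inj_on f E"
    and indep'_iff: "\<And>Y. indep' Y \<longleftrightarrow> (\<exists>X. indep X \<and> Y = f ` X)"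
begin

lemma indep'_image: "X \<subseteq> E \<Longrightarrow> indep' (f ` X) \<longleftrightarrow> indep X"
  by (metis indep'_iff indep_subset_ground inj inj_on_image_eq_iff)

lemma card_copy: "X \<subseteq> E \<Longrightarrow> card (f ` X) = card X"
  using inj by (metis card_image inj_on_subset)

lemma image_copy_subset: "\<lbrakk>X \<subseteq> E; Y \<subseteq> E\<rbrakk> \<Longrightarrow> f ` X \<subseteq> f ` Y \<longleftrightarrow> X \<subseteq> Y"
  using inj by (blast dest: inj_onD)

lemma matroid_copy: "matroid (f ` E) indep'"
proof
  show "finite (f ` E)" using finite_ground by simp
  show "indep' {}" using indep'_iff indep_empty by auto
  show "X \<subseteq> f ` E" if "indep' X" for X
    using that indep'_iff indep_subset_ground by blast
  show "indep' Y" if "indep' X" "Y \<subseteq> X" for X Y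
    using that by (metis indep'_iff indep_subset subset_imageE)
  show "\<exists>x\<in>X - Y. indep' (insert x Y)"
    if X: "indep' X" and Y: "indep' Y" and c: "card X = card Y + 1" for X Y
  proof -
    obtain X0 where X0: "indep X0" "X = f ` X0" using X indep'_iff by metis
    obtain Y0 where Y0: "indep Y0" "Y = f ` Y0" using Y indep'_iff by metis
    note XY = X0 Y0
    then have sub: "X0 \<subseteq> E" "Y0 \<subseteq> E" by (simp_all add: indep_subset_ground)
    then have "card X0 = card Y0 + 1" using c XY card_copy[of X0] card_copy[of Y0] by simp
    then obtain x where x: "x \<in> X0 - Y0" "indep (insert x Y0)"
      using augment[OF X0(1) Y0(1)] by blast
    have "f x \<notin> Y" using x XY sub inj_on_image_mem_iff[OF inj, of x Y0] by auto
    then have "f x \<in> X - Y" using x XY by blast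
    moreover have "indep' (insert (f x) Y)" using x(2) Y0(2) indep'_iff image_insert by metis
    ultimately show ?thesis by blast
  qed
qed

lemma rank_copy:
  assumes "X \<subseteq> E" shows "matroid_rank indep' (f ` X) = matroid_rank indep X"
proof -
  have "{Y. Y \<subseteq> f ` X \<and> indep' Y} = (`) f ` {Y. Y \<subseteq> X \<and> indep Y}"
  proof (intro Set.set_eqI iffI)
    fix Y assume "Y \<in> {Y. Y \<subseteq> f ` X \<and> indep' Y}"
    then obtain Y0 where "Y0 \<subseteq> X" "Y = f ` Y0" "indep' Y" by (auto simp: subset_image_iff)
    then show "Y \<in> (`) f ` {Y. Y \<subseteq> X \<and> indep Y}"
      using indep'_image[of Y0] assms by auto
  next
    fix Y assume "Y \<in> (`) f ` {Y. Y \<subseteq> X \<and> indep Y}"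
    then show "Y \<in> {Y. Y \<subseteq> f ` X \<and> indep' Y}" using indep'_iff by auto
  qed
  moreover have "card ` (`) f ` {Y. Y \<subseteq> X \<and> indep Y} = card ` {Y. Y \<subseteq> X \<and> indep Y}"
    unfolding image_image using assms by (intro image_cong refl card_copy) auto
  ultimately show ?thesis unfolding matroid_rank_def by simp
qed

lemma flat_copy:
  assumes "X \<subseteq> E" shows "flat (f ` E) indep' (f ` X) \<longleftrightarrow> flat E indep X"
proof -
  have "f ` E - f ` X = f ` (E - X)"
    using inj_on_image_set_diff[OF inj, of E X] assms by auto
  moreover have "matroid_rank indep' (insert (f e) (f ` X)) = matroid_rank indep (insert e X)"
    if "e \<in> E" for e
    using rank_copy[of "insert e X"] that assms by simp
  ultimately show ?thesis
    unfolding flat_def using assms rank_copy[OF assms] by auto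
qed

lemma basis_copy:
  assumes "X \<subseteq> E" "B \<subseteq> E"
  shows "matroid_basis (restrict_indep indep' (f ` X)) (f ` B) \<longleftrightarrow>
         matroid_basis (restrict_indep indep X) B"
proof -
  have sub: "f ` Y \<subseteq> f ` Z \<longleftrightarrow> Y \<subseteq> Z" if "Y \<subseteq> E" "Z \<subseteq> E" for Y Z
    by (rule image_copy_subset[OF that])
  have eq: "f ` Y = f ` Z \<longleftrightarrow> Y = Z" if "Y \<subseteq> E" "Z \<subseteq> E" for Y Z
    using inj that by (simp add: inj_on_image_eq_iff)
  have r: "restrict_indep indep' (f ` X) (f ` Y) \<longleftrightarrow> restrict_indep indep X Y" if "Y \<subseteq> E" for Y
    unfolding restrict_indep_def using sub indep'_image that assms by simp
  have "(\<forall>Y'. restrict_indep indep' (f ` X) Y' \<longrightarrow> f ` B \<subseteq> Y' \<longrightarrow> Y' = f ` B) \<longleftrightarrow>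
        (\<forall>Y. restrict_indep indep X Y \<longrightarrow> B \<subseteq> Y \<longrightarrow> Y = B)" (is "?l \<longleftrightarrow> ?r")
  proof
    assume l: ?l
    show ?r
    proof (intro allI impI)
      fix Y assume Y: "restrict_indep indep X Y" "B \<subseteq> Y"
      then have "Y \<subseteq> E" using assms unfolding restrict_indep_def by auto
      then show "Y = B" using l Y r[of Y] eq[of Y B] assms by (metis image_mono)
    qed
  next
    assume r': ?r
    show ?l
    proof (intro allI impI)
      fix Y' assume Y': "restrict_indep indep' (f ` X) Y'" "f ` B \<subseteq> Y'"
      then obtain Y where Y: "Y \<subseteq> X" "Y' = f ` Y"
        unfolding restrict_indep_def by (auto simp: subset_image_iff)
      then have "Y \<subseteq> E" using assms by auto
      then show "Y' = f ` B" using r' Y Y' r[of Y] sub[of B Y] assms by auto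
    qed
  qed
  then show ?thesis unfolding matroid_basis_def using r[OF assms(2)] by simp
qed

lemma isthmus_copy:
  assumes "X \<subseteq> E" "e \<in> E"
  shows "isthmus (f ` X) (restrict_indep indep' (f ` X)) (f e) \<longleftrightarrow>
         isthmus X (restrict_indep indep X) e"
proof -
  have mem: "f e \<in> f ` Y \<longleftrightarrow> e \<in> Y" if "Y \<subseteq> E" for Y
    using inj that assms by (simp add: inj_on_image_mem_iff)
  have "(\<forall>B'. matroid_basis (restrict_indep indep' (f ` X)) B' \<longrightarrow> f e \<in> B') \<longleftrightarrow>
        (\<forall>B. matroid_basis (restrict_indep indep X) B \<longrightarrow> e \<in> B)" (is "?l \<longleftrightarrow> ?r")
  proof
    assume l: ?l
    show ?r
    proof (intro allI impI)
      fix B assume B: "matroid_basis (restrict_indep indep X) B"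
      then have "B \<subseteq> E" using assms unfolding matroid_basis_def restrict_indep_def by auto
      then show "e \<in> B" using l B basis_copy[of X B] mem assms by auto
    qed
  next
    assume r: ?r
    show ?l
    proof (intro allI impI)
      fix B' assume B': "matroid_basis (restrict_indep indep' (f ` X)) B'"
      then obtain B where B: "B \<subseteq> X" "B' = f ` B"
        unfolding matroid_basis_def restrict_indep_def by (auto simp: subset_image_iff)
      then have "B \<subseteq> E" using assms by auto
      then show "f e \<in> B'" using r B B' basis_copy[of X B] mem assms by auto
    qed
  qed
  then show ?thesis unfolding isthmus_def using mem[OF assms(1)] by simp
qed

lemma cyclic_flat_copy:
  assumes "X \<subseteq> E" shows "cyclic_flat (f ` E) indep' (f ` X) \<longleftrightarrow> cyclic_flat E indep X"
proof -
  have "(\<exists>e'. isthmus (f ` X) (restrict_indep indep' (f ` X)) e') \<longleftrightarrow>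
        (\<exists>e\<in>X. isthmus (f ` X) (restrict_indep indep' (f ` X)) (f e))"
    unfolding isthmus_def by blast
  also have "\<dots> \<longleftrightarrow> (\<exists>e\<in>X. isthmus X (restrict_indep indep X) e)"
    using isthmus_copy[OF assms] assms by blast
  also have "\<dots> \<longleftrightarrow> (\<exists>e. isthmus X (restrict_indep indep X) e)"
    unfolding isthmus_def by blast
  finally show ?thesis unfolding cyclic_flat_def using flat_copy[OF assms] by simp
qed

lemma order_isomorphic_copy:
  assumes "order_isomorphic (cyclic_flats E indep) L"
  shows "order_isomorphic (cyclic_flats (f ` E) indep') L"
proof -
  obtain h where h: "order_emb (cyclic_flats E indep) L h"
    "bij_betw h {X. cyclic_flat E indep X} (carrier L)"
    using assms unfolding order_isomorphic_def cyclic_flats_def by auto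
  have ground: "{X. cyclic_flat E indep X} \<subseteq> Pow E"
    unfolding cyclic_flat_def flat_def by auto
  have ground': "{X. cyclic_flat (f ` E) indep' X} \<subseteq> Pow (f ` E)"
    unfolding cyclic_flat_def flat_def by auto
  have injP: "inj_on ((`) f) (Pow E)" using inj by (rule inj_on_image_Pow)
  have img: "(`) f ` {X. cyclic_flat E indep X} = {X. cyclic_flat (f ` E) indep' X}"
  proof (intro Set.set_eqI iffI)
    fix Y assume "Y \<in> (`) f ` {X. cyclic_flat E indep X}"
    then show "Y \<in> {X. cyclic_flat (f ` E) indep' X}" using cyclic_flat_copy ground by auto
  next
    fix Y assume Y: "Y \<in> {X. cyclic_flat (f ` E) indep' X}"
    then have "Y \<subseteq> f ` E" using ground' by auto
    then obtain X where "X \<subseteq> E" "Y = f ` X" by (auto simp: subset_image_iff)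
    then show "Y \<in> (`) f ` {X. cyclic_flat E indep X}" using Y cyclic_flat_copy by auto
  qed
  have b: "bij_betw ((`) f) {X. cyclic_flat E indep X} {X. cyclic_flat (f ` E) indep' X}"
    using img injP ground unfolding bij_betw_def by (auto intro: inj_on_subset)
  define k where "k = the_inv_into {X. cyclic_flat E indep X} ((`) f)"
  have kb: "bij_betw k {X. cyclic_flat (f ` E) indep' X} {X. cyclic_flat E indep X}"
    unfolding k_def using b by (rule bij_betw_the_inv_into)
  have fk: "f ` k Y = Y" if "cyclic_flat (f ` E) indep' Y" for Y
    unfolding k_def using b that by (simp add: bij_betw_def f_the_inv_into_f)
  have kE: "cyclic_flat E indep (k Y)" if "cyclic_flat (f ` E) indep' Y" for Y
    using kb that by (auto dest: bij_betwE)
  have kle: "k X \<subseteq> k Y \<longleftrightarrow> X \<subseteq> Y"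
    if "cyclic_flat (f ` E) indep' X" "cyclic_flat (f ` E) indep' Y" for X Y
  proof -
    have "k X \<subseteq> E" "k Y \<subseteq> E" using kE that ground by auto
    then have "k X \<subseteq> k Y \<longleftrightarrow> f ` k X \<subseteq> f ` k Y" by (simp add: image_copy_subset)
    then show ?thesis using fk that by simp
  qed
  have po: "weak_partial_order (cyclic_flats (f ` E) indep')"
    unfolding cyclic_flats_def by unfold_locales auto
  have "order_emb (cyclic_flats (f ` E) indep') L (h \<circ> k)"
    using h(1) po kE kle unfolding order_emb_def by (simp add: cyclic_flats_def)
  moreover have "bij_betw (h \<circ> k) {X. cyclic_flat (f ` E) indep' X} (carrier L)"
    using kb h(2) by (rule bij_betw_trans)
  ultimately show ?thesis unfolding order_isomorphic_def cyclic_flats_def by auto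
qed

lemma transversal_copy:
  assumes "transversal_matroid (f ` E) indep'"
  shows "transversal_matroid E indep"
proof -
  obtain r :: nat and A where A:
    "\<And>Y. indep' Y \<longleftrightarrow>
       Y \<subseteq> f ` E \<and> (\<exists>\<phi>. inj_on \<phi> Y \<and> (\<forall>y\<in>Y. \<phi> y < r \<and> y \<in> A (\<phi> y)))"
    using assms unfolding transversal_matroid_def by metis
  have "indep X \<longleftrightarrow> X \<subseteq> E \<and>
      (\<exists>\<psi>. inj_on \<psi> X \<and> (\<forall>x\<in>X. \<psi> x < r \<and> x \<in> {x \<in> E. f x \<in> A (\<psi> x)}))" for X
  proof (cases "X \<subseteq> E")
    case True
    then have injX: "inj_on f X" using inj inj_on_subset by blast
    have "indep X \<longleftrightarrow> (\<exists>\<phi>. inj_on \<phi> (f ` X) \<and> (\<forall>x\<in>X. \<phi> (f x) < r \<and> f x \<in> A (\<phi> (f x))))"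
      using A[of "f ` X"] indep'_image True by auto
    also have "\<dots> \<longleftrightarrow> (\<exists>\<psi>. inj_on \<psi> X \<and> (\<forall>x\<in>X. \<psi> x < r \<and> f x \<in> A (\<psi> x)))" (is "?l \<longleftrightarrow> ?r")
    proof
      assume ?l
      then obtain \<phi> where
        \<phi>: "inj_on \<phi> (f ` X)" "\<forall>x\<in>X. \<phi> (f x) < r \<and> f x \<in> A (\<phi> (f x))" by blast
      then have "inj_on (\<phi> \<circ> f) X" using injX comp_inj_on by blast
      then show ?r using \<phi>(2) by (intro exI[of _ "\<phi> \<circ> f"]) simp
    next
      assume ?r
      then obtain \<psi> where \<psi>: "inj_on \<psi> X" "\<forall>x\<in>X. \<psi> x < r \<and> f x \<in> A (\<psi> x)" by blast
      have g: "the_inv_into X f (f x) = x" if "x \<in> X" for x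
        using injX that by (rule the_inv_into_f_f)
      have "inj_on (\<psi> \<circ> the_inv_into X f) (f ` X)"
        using \<psi>(1) g by (auto simp: inj_on_def)
      then show ?l using \<psi>(2) g by (intro exI[of _ "\<psi> \<circ> the_inv_into X f"]) simp
    qed
    finally show ?thesis using True by auto
  next
    case False
    then show ?thesis using indep_subset_ground by blast
  qed
  moreover have "\<forall>j<r. {x \<in> E. f x \<in> A j} \<subseteq> E" by auto
  ultimately show ?thesis
    unfolding transversal_matroid_def
    by (intro conjI exI[of _ r] exI[of _ "\<lambda>j. {x \<in> E. f x \<in> A j}"] matroid_axioms) auto
qed

end

lemma Tr_lattice_transversal:
  fixes E :: "'e set"
  assumes L: "Tr_lattice L" and M: "matroid E indep"
    and iso: "order_isomorphic (cyclic_flats E indep) L"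
  shows "transversal_matroid E indep"
proof -
  interpret matroid E indep by (rule M)
  obtain f :: "'e \<Rightarrow> nat" where f: "inj_on f E"
    using finite_imp_inj_to_nat_seg[OF finite_ground] by blast
  interpret matroid_copy E indep f "\<lambda>Y. \<exists>X. indep X \<and> Y = f ` X"
    by unfold_locales (use f in auto)
  show ?thesis
    using L matroid_copy order_isomorphic_copy[OF iso] transversal_copy
    unfolding Tr_lattice_def by blast
qed

end

theory Submission
  imports Defs
begin

text \<open>Let \<open>M\<close> be a matroid whose lattice of cyclic flats is \<open>L1 * L2\<close>, let \<open>T\<close> be its largest cyclic
  flat, and let \<open>b1\<close>, \<open>b2\<close> be the cyclic flats that correspond to the least elements of \<open>L1\<close>, \<open>L2\<close>
  (or \<open>T\<close>, if the lattice is trivial). The cyclic flats of the contraction \<open>M / bi\<close> form a lattice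
  isomorphic to \<open>Li\<close>, so \<open>M / bi\<close> is transversal. Intersect the sets of both presentations with \<open>T\<close>,
  and add \<open>r(b1) + r(b2) - r(T)\<close> copies of the set of non-loops of \<open>T\<close> and one singleton for each
  isthmus. This family presents \<open>M\<close>: as \<open>b1 \<union> b2\<close> spans \<open>T\<close>, submodularity gives Hall's condition
  for independent sets. Conversely, a circuit with closure \<open>F \<supseteq> b1\<close> violates it, since the cyclic set
  \<open>F - b1\<close> meets only \<open>r(F) - r(b1)\<close> sets of the first presentation, and only \<open>r(T) - r(b2)\<close> sets of
  the second one meet \<open>T\<close>; the case \<open>F \<supseteq> b2\<close> is symmetric.\<close>

section \<open>Hall's theorem with defect\<close>

text \<open>The neighbourhood of \<open>Y\<close> in the bipartite graph of elements and indices,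
  whose size is the right-hand side of Hall's condition. Indices are collected rather than sets, so
  repeated sets count with multiplicity.\<close>

definition hits :: "'i set \<Rightarrow> ('i \<Rightarrow> 'e set) \<Rightarrow> 'e set \<Rightarrow> 'i set" where
  "hits I A Y = {i \<in> I. A i \<inter> Y \<noteq> {}}"

text \<open>The index type is arbitrary so that families can be joined along \<open><+>\<close>;
  \<open>transversal_matroidI\<close> returns to indices below a natural number.\<close>

definition matches :: "'i set \<Rightarrow> ('i \<Rightarrow> 'e set) \<Rightarrow> ('e \<Rightarrow> 'i) \<Rightarrow> 'e set \<Rightarrow> bool" where
  "matches I A \<phi> X \<longleftrightarrow> inj_on \<phi> X \<and> (\<forall>x\<in>X. \<phi> x \<in> I \<and> x \<in> A (\<phi> x))"

lemma finite_hits: "finite I \<Longrightarrow> finite (hits I A Y)"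
  unfolding hits_def by simp

lemma hits_mono: "Y \<subseteq> Z \<Longrightarrow> hits I A Y \<subseteq> hits I A Z"
  unfolding hits_def by auto

lemma card_hits_mono: "finite I \<Longrightarrow> Y \<subseteq> Z \<Longrightarrow> card (hits I A Y) \<le> card (hits I A Z)"
  by (simp add: card_mono finite_hits hits_mono)

lemma hits_Plus: "hits (I <+> J) (case_sum A B) Y = hits I A Y <+> hits J B Y"
  unfolding hits_def by auto

lemma matches_subset: "matches I A \<phi> X \<Longrightarrow> Y \<subseteq> X \<Longrightarrow> matches I A \<phi> Y"
  unfolding matches_def by (auto intro: inj_on_subset)

lemma matches_card_le:
  assumes "finite I" "matches I A \<phi> X"
  shows "card X \<le> card (hits I A X)"
proof -
  have "\<phi> ` X \<subseteq> hits I A X" using assms(2) unfolding matches_def hits_def by auto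
  then show ?thesis
    using assms card_inj_on_le[of \<phi> X "hits I A X"] finite_hits unfolding matches_def by blast
qed

text \<open>The indices hit by \<open>W \<union> Y\<close> are those hit by \<open>Y\<close> and the
  remaining ones hit by \<open>W\<close>. Subtracting the equality for \<open>Y\<close> from Hall's
  condition for \<open>W \<union> Y\<close> leaves the condition for \<open>W\<close>.\<close>

lemma Hall_tight_split:
  assumes "finite X" "finite I" "Y \<subseteq> X" "card Y = card (hits I A Y)"
    and "\<And>Z. Z \<subseteq> X \<Longrightarrow> card Z \<le> card (hits I A Z)" and "W \<subseteq> X - Y"
  shows "card W \<le> card (hits (I - hits I A Y) A W)"
proof -
  have eq: "hits I A (W \<union> Y) = hits (I - hits I A Y) A W \<union> hits I A Y"
    unfolding hits_def by auto
  have fin: "finite W" "finite Y" using assms by (auto intro: finite_subset)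
  have "card W + card Y = card (W \<union> Y)"
    using fin assms(6) by (subst card_Un_disjoint) auto
  also have "\<dots> \<le> card (hits I A (W \<union> Y))" using assms(3,5,6) by blast
  also have "\<dots> = card (hits (I - hits I A Y) A W) + card (hits I A Y)"
    unfolding eq using assms(2) by (subst card_Un_disjoint) (auto simp: hits_def)
  finally show ?thesis using assms(4) by simp
qed

text \<open>Induction on \<open>card X\<close>. If a nonempty proper subset attains equality, it is
  matched first and the rest by \<open>Hall_tight_split\<close>. Otherwise every nonempty proper
  subset has an index to spare, so any element may take any of its indices and that index may be
  removed.\<close>

lemma Hall:
  assumes "finite X" "finite I" "\<And>Y. Y \<subseteq> X \<Longrightarrow> card Y \<le> card (hits I A Y)"
  shows "\<exists>\<phi>. matches I A \<phi> X"
  using assms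
proof (induction "card X" arbitrary: X I rule: less_induct)
  case less
  show ?case
  proof (cases "X = {}")
    case True
    then show ?thesis unfolding matches_def by simp
  next
    case nonempty: False
    show ?thesis
    proof (cases "\<exists>Y. Y \<noteq> {} \<and> Y \<subset> X \<and> card Y = card (hits I A Y)")
      case True
      then obtain Y where Y: "Y \<noteq> {}" "Y \<subset> X" "card Y = card (hits I A Y)" by blast
      define J where "J = I - hits I A Y"
      have cY: "card Y < card X" using Y(2) less.prems(1) by (rule psubset_card_mono[rotated])
      have "X - Y \<subset> X" using Y by blast
      then have cW: "card (X - Y) < card X" using less.prems(1) by (rule psubset_card_mono[rotated])
      have "\<exists>\<phi>. matches I A \<phi> Y"
        using Y less.prems by (intro less.hyps[OF cY]) (auto intro: finite_subset)
      then obtain \<phi> where \<phi>: "matches I A \<phi> Y" by blast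
      have "\<exists>\<psi>. matches J A \<psi> (X - Y)"
      proof (rule less.hyps[OF cW])
        show "card W \<le> card (hits J A W)" if "W \<subseteq> X - Y" for W
          unfolding J_def using less.prems Y that by (intro Hall_tight_split[of X]) auto
      qed (use less.prems J_def in auto)
      then obtain \<psi> where \<psi>: "matches J A \<psi> (X - Y)" by blast
      have "matches I A (\<lambda>x. if x \<in> Y then \<phi> x else \<psi> x) X"
        using \<phi> \<psi> unfolding matches_def J_def hits_def inj_on_def
        by (simp split: if_splits) (metis DiffI IntI empty_iff)
      then show ?thesis by blast
    next
      case False
      then have strict: "card Y < card (hits I A Y)" if "Y \<noteq> {}" "Y \<subset> X" for Y
        using that less.prems(3)[of Y] by (metis le_neq_implies_less psubset_imp_subset)
      obtain x where x: "x \<in> X" using nonempty by blast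
      have "hits I A {x} \<noteq> {}" using less.prems(3)[of "{x}"] x by auto
      then obtain i where i: "i \<in> I" "x \<in> A i" unfolding hits_def by auto
      have cx: "card (X - {x}) < card X" using x less.prems(1) by (rule card_Diff1_less[rotated])
      have "\<exists>\<psi>. matches (I - {i}) A \<psi> (X - {x})"
      proof (rule less.hyps[OF cx])
        show "card W \<le> card (hits (I - {i}) A W)" if W: "W \<subseteq> X - {x}" for W
        proof (cases "W = {}")
          case False
          have "hits (I - {i}) A W = hits I A W - {i}" unfolding hits_def by auto
          then have "card (hits I A W) \<le> card (hits (I - {i}) A W) + 1"
            by (cases "i \<in> hits I A W") simp_all
          moreover have "card W < card (hits I A W)" using False W x by (intro strict) auto
          ultimately show ?thesis by simp
        qed simp
      qed (use less.prems in auto)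
      then obtain \<psi> where \<psi>: "matches (I - {i}) A \<psi> (X - {x})" by blast
      have "matches I A (\<psi>(x := i)) X"
        using \<psi> i unfolding matches_def inj_on_def by auto
      then show ?thesis by blast
    qed
  qed
qed

lemma matches_iff_Hall:
  assumes "finite X" "finite I"
  shows "(\<exists>\<phi>. matches I A \<phi> X) \<longleftrightarrow> (\<forall>Y\<subseteq>X. card Y \<le> card (hits I A Y))"
  using Hall[OF assms, of A] matches_card_le[OF assms(2), of A] matches_subset[of I A _ X] by blast

text \<open>Pad the family with as many universal sets as the largest defect, apply Hall's theorem,
  and discard the elements matched to the padding.\<close>

lemma Hall_defect:
  fixes A :: "'i \<Rightarrow> 'e set"
  assumes "finite X" "finite I"
  obtains B Y \<phi> where "B \<subseteq> X" "Y \<subseteq> X" "matches I A \<phi> B"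
    "card (X - Y) + card (hits I A Y) \<le> card B"
proof -
  define def where "def Y = card Y - card (hits I A Y)" for Y
  have "finite (def ` Pow X)" "def ` Pow X \<noteq> {}" using assms by auto
  then have "Max (def ` Pow X) \<in> def ` Pow X" "\<And>Z. Z \<subseteq> X \<Longrightarrow> def Z \<le> Max (def ` Pow X)"
    by (auto intro: Max_in)
  then obtain Y where Y: "Y \<subseteq> X" "\<And>Z. Z \<subseteq> X \<Longrightarrow> def Z \<le> def Y" by auto
  define d where "d = def Y"
  define J :: "('i + nat) set" where "J = I <+> {..<d}"
  define A' :: "'i + nat \<Rightarrow> 'e set" where "A' = case_sum A (\<lambda>_. UNIV)"
  \<comment> \<open>The padding sets are universal, so every nonempty \<open>Z\<close> meets all of
    them; the empty set meets none.\<close>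
  have hits: "hits J A' Z = hits I A Z <+> {..<d}" if "Z \<noteq> {}" for Z
    using that unfolding hits_def J_def A'_def by auto
  have "card Z \<le> card (hits J A' Z)" if Z: "Z \<subseteq> X" for Z
  proof (cases "Z = {}")
    case False
    have "card (hits J A' Z) = card (hits I A Z) + d"
      unfolding hits[OF False] using assms by (simp add: card_Plus finite_hits)
    moreover have "def Z \<le> d" using Y(2)[OF Z] d_def by simp
    ultimately show ?thesis unfolding def_def by simp
  qed simp
  then obtain \<phi> where \<phi>: "matches J A' \<phi> X"
    using Hall[of X J A'] assms unfolding J_def by auto
  define B where "B = {x \<in> X. \<phi> x \<in> range Inl}"
  define \<psi> where "\<psi> x = projl (\<phi> x)" for x
  have "matches I A \<psi> B"
    using \<phi> unfolding matches_def B_def \<psi>_def J_def A'_def inj_on_def by fastforce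
  moreover have "card (X - B) \<le> d"
  proof -
    have "\<phi> ` (X - B) \<subseteq> Inr ` {..<d}"
      using \<phi> unfolding matches_def B_def J_def by auto
    moreover have "inj_on \<phi> (X - B)"
      using \<phi> unfolding matches_def by (auto intro: inj_on_subset)
    ultimately have "card (X - B) \<le> card (Inr ` {..<d} :: ('i + nat) set)"
      by (intro card_inj_on_le) auto
    then show ?thesis by (simp add: card_image)
  qed
  moreover have B: "B \<subseteq> X" unfolding B_def by auto
  \<comment> \<open>Since \<open>def\<close> is a truncated difference, \<open>d = 0\<close> does
    not give equality for \<open>Y\<close>. In that case all of \<open>X\<close> is matched and the
    empty set serves as the witness.\<close>
  moreover consider "d = 0" | "d > 0" "card Y = card (hits I A Y) + d"
    unfolding d_def def_def by linarith
  then have "\<exists>Y\<subseteq>X. card (X - Y) + card (hits I A Y) \<le> card B"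
  proof cases
    case 1
    then have "X - B = {}" using calculation(2) assms by simp
    then have "card (X - {}) + card (hits I A {}) \<le> card B" using B by (simp add: hits_def subset_antisym)
    then show ?thesis by blast
  next
    case 2
    have "finite B" "finite Y" using B Y(1) assms(1) by (auto intro: finite_subset)
    then have "card (X - B) = card X - card B" "card (X - Y) = card X - card Y"
      "card Y \<le> card X" using B Y(1) assms(1) by (auto simp: card_Diff_subset card_mono)
    then show ?thesis using 2 calculation(2) Y(1) by (intro exI[of _ Y]) auto
  qed
  ultimately show ?thesis using that by blast
qed

text \<open>A bijection \<open>g\<close> renumbers the index set as an initial segment of the
  naturals; matchings are carried across by composing with \<open>g\<close> or its inverse.\<close>

lemma transversal_matroidI:
  fixes A :: "'i \<Rightarrow> 'e set"
  assumes "matroid E indep" "finite I" "\<And>i. i \<in> I \<Longrightarrow> A i \<subseteq> E"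
    and "\<And>X. indep X \<longleftrightarrow> X \<subseteq> E \<and> (\<exists>\<phi>. matches I A \<phi> X)"
  shows "transversal_matroid E indep"
proof -
  obtain g where "bij_betw g {0..<card I} I" using ex_bij_betw_nat_finite[OF assms(2)] by blast
  then have g: "bij_betw g {..<card I} I" by (simp add: atLeast0LessThan)
  let ?h = "the_inv_into {..<card I} g"
  have h: "bij_betw ?h I {..<card I}" using g by (rule bij_betw_the_inv_into)
  have gh: "g (?h i) = i" if "i \<in> I" for i
    using g that by (simp add: bij_betw_def f_the_inv_into_f)
  have "(\<exists>\<phi>. matches I A \<phi> X) \<longleftrightarrow>
      (\<exists>\<phi>. inj_on \<phi> X \<and> (\<forall>x\<in>X. \<phi> x < card I \<and> x \<in> A (g (\<phi> x))))" (is "?l \<longleftrightarrow> ?r") for X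
  proof
    assume ?l
    then obtain \<phi> where \<phi>: "inj_on \<phi> X" "\<phi> ` X \<subseteq> I" "\<forall>x\<in>X. x \<in> A (\<phi> x)"
      unfolding matches_def by auto
    have "inj_on (?h \<circ> \<phi>) X" using \<phi> h by (meson bij_betw_def comp_inj_on inj_on_subset)
    moreover have "\<forall>x\<in>X. (?h \<circ> \<phi>) x < card I \<and> x \<in> A (g ((?h \<circ> \<phi>) x))"
      using \<phi> gh h by (auto simp: image_subset_iff bij_betw_def)
    ultimately show ?r by blast
  next
    assume ?r
    then obtain \<phi> where \<phi>: "inj_on \<phi> X" "\<phi> ` X \<subseteq> {..<card I}" "\<forall>x\<in>X. x \<in> A (g (\<phi> x))" by auto
    have "inj_on (g \<circ> \<phi>) X" using \<phi> g by (meson bij_betw_def comp_inj_on inj_on_subset)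
    then have "matches I A (g \<circ> \<phi>) X"
      using \<phi> g unfolding matches_def by (auto simp: bij_betw_def)
    then show ?l by blast
  qed
  moreover have "\<forall>j<card I. A (g j) \<subseteq> E" using g assms(3) by (auto simp: bij_betw_def)
  ultimately show ?thesis
    unfolding transversal_matroid_def using assms(1,4)
    by (intro conjI exI[of _ "card I"] exI[of _ "\<lambda>j. A (g j)"]) simp_all
qed

lemma transversal_matroidE:
  assumes "transversal_matroid E indep"
  obtains r :: nat and A where "\<And>j. j < r \<Longrightarrow> A j \<subseteq> E"
    "\<And>X. indep X \<longleftrightarrow> X \<subseteq> E \<and> (\<exists>\<phi>. matches {..<r} A \<phi> X)"
proof -
  obtain r :: nat and A where "\<forall>j<r. A j \<subseteq> E"
    "\<forall>X. indep X \<longleftrightarrow> X \<subseteq> E \<and> (\<exists>\<phi>. inj_on \<phi> X \<and> (\<forall>x\<in>X. \<phi> x < r \<and> x \<in> A (\<phi> x)))"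
    using assms unfolding transversal_matroid_def by - (elim conjE exE, rule that, assumption+)
  then show ?thesis by (intro that[of r A]) (simp_all add: matches_def)
qed

section \<open>Rank, closure and cyclic sets\<close>

context matroid
begin

abbreviation rank :: "'e set \<Rightarrow> nat" where
  "rank \<equiv> matroid_rank indep"

lemma finite_indep: "indep X \<Longrightarrow> finite X"
  using finite_ground indep_subset_ground finite_subset by blast

lemma finite_indep_cards: "finite (card ` {Y. Y \<subseteq> X \<and> indep Y})"
proof -
  have "{Y. Y \<subseteq> X \<and> indep Y} \<subseteq> Pow E" using indep_subset_ground by auto
  then show ?thesis using finite_ground by (auto intro: finite_subset)
qed

lemma rank_ge: "indep Y \<Longrightarrow> Y \<subseteq> X \<Longrightarrow> card Y \<le> rank X"
  unfolding matroid_rank_def using finite_indep_cards by (intro Max_ge) auto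

lemma rank_witness: obtains B where "B \<subseteq> X" "indep B" "card B = rank X"
proof -
  have "rank X \<in> card ` {Y. Y \<subseteq> X \<and> indep Y}"
    unfolding matroid_rank_def using finite_indep_cards indep_empty by (intro Max_in) auto
  then show ?thesis using that by auto
qed

text \<open>\<open>X\<close> is trimmed to one element more than \<open>Y\<close>, where the axiom
  applies.\<close>

lemma augment_less:
  assumes "indep X" "indep Y" "card Y < card X"
  obtains x where "x \<in> X - Y" "indep (insert x Y)"
proof -
  obtain X' where "X' \<subseteq> X" "card X' = card Y + 1"
    using assms(3) obtain_subset_with_card_n[of "card Y + 1" X] by auto
  then show ?thesis using augment[of X' Y] indep_subset assms that by blast
qed

lemma extend_to_rank:
  assumes "indep I" "I \<subseteq> X"
  obtains B where "I \<subseteq> B" "B \<subseteq> X" "indep B" "card B = rank X"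
  using assms
proof (induction "rank X - card I" arbitrary: I thesis rule: less_induct)
  case less
  show ?case
  proof (cases "card I = rank X")
    case True
    then show ?thesis using less.prems by blast
  next
    case False
    then have lt: "card I < rank X" using rank_ge[of I X] less.prems by simp
    obtain B where B: "B \<subseteq> X" "indep B" "card B = rank X" by (rule rank_witness)
    obtain x where x: "x \<in> B - I" "indep (insert x I)"
      using augment_less[of B I] B lt less.prems by auto
    have "card (insert x I) = card I + 1" using x finite_indep less.prems by simp
    then have "rank X - card (insert x I) < rank X - card I" using lt by simp
    from less.hyps[OF this] x B less.prems show ?thesis
      by (metis DiffD1 insert_subset subset_iff)
  qed
qed

lemma rank_mono: "X \<subseteq> Y \<Longrightarrow> rank X \<le> rank Y"
  using rank_witness[of X] rank_ge[of _ Y] by (metis order_trans)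

lemma rank_le_card: "finite X \<Longrightarrow> rank X \<le> card X"
  using rank_witness[of X] card_mono[of X] by metis

lemma indep_iff_rank:
  assumes "finite X" shows "indep X \<longleftrightarrow> rank X = card X"
proof
  show "rank X = card X" if "indep X"
    using rank_ge[OF that order_refl] rank_le_card[OF assms] by simp
  show "indep X" if "rank X = card X"
    using rank_witness[of X] card_subset_eq[OF assms] that by metis
qed

text \<open>Extend a basis \<open>I\<close> of \<open>X \<inter> Y\<close> to a basis
  \<open>B\<close> of \<open>X \<union> Y\<close>. The parts of \<open>B\<close> in \<open>X\<close>
  and in \<open>Y\<close> are independent, and their sizes add up to
  \<open>card B + card (B \<inter> X \<inter> Y)\<close>, where the last set contains
  \<open>I\<close>.\<close>

lemma rank_submodular: "rank (X \<union> Y) + rank (X \<inter> Y) \<le> rank X + rank Y"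
proof -
  obtain I where I: "I \<subseteq> X \<inter> Y" "indep I" "card I = rank (X \<inter> Y)" by (rule rank_witness)
  obtain B where B: "I \<subseteq> B" "B \<subseteq> X \<union> Y" "indep B" "card B = rank (X \<union> Y)"
    using extend_to_rank[of I "X \<union> Y"] I by blast
  have fin: "finite B" using B finite_indep by blast
  have "card B + card (B \<inter> X \<inter> Y) = card (B \<inter> X) + card (B \<inter> Y)"
    using fin B(2) card_Un_Int[of "B \<inter> X" "B \<inter> Y"]
    by (metis Int_Un_distrib Int_absorb2 Int_assoc Int_left_commute finite_Int inf_left_idem)
  moreover have "card I \<le> card (B \<inter> X \<inter> Y)" using I B fin by (intro card_mono) auto
  moreover have "card (B \<inter> X) \<le> rank X" "card (B \<inter> Y) \<le> rank Y"
    using B(3) indep_subset by (auto intro!: rank_ge)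
  ultimately show ?thesis using I B by linarith
qed

text \<open>Submodularity for \<open>insert e X\<close> and \<open>Y\<close>, which have union
  \<open>insert e Y\<close> and, if \<open>e\<close> is not in \<open>Y\<close>, intersection
  \<open>X\<close>. The facts on closures and on cyclic sets below rest on this.\<close>

lemma rank_insert_eq_mono:
  assumes "X \<subseteq> Y" "rank (insert e X) = rank X"
  shows "rank (insert e Y) = rank Y"
proof (cases "e \<in> Y")
  case False
  have "insert e X \<union> Y = insert e Y" "insert e X \<inter> Y = X" using assms(1) False by auto
  then have "rank (insert e Y) \<le> rank Y"
    using rank_submodular[of "insert e X" Y] assms(2) by simp
  then show ?thesis using rank_mono[OF subset_insertI, of Y e] by simp
qed (simp add: insert_absorb)

lemma rank_Un_eq:
  assumes "finite Z" "\<And>e. e \<in> Z \<Longrightarrow> rank (insert e X) = rank X"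
  shows "rank (X \<union> Z) = rank X"
  using assms
proof (induction Z)
  case (insert e Z)
  have "rank (insert e (X \<union> Z)) = rank (X \<union> Z)"
    using insert.prems by (rule rank_insert_eq_mono[of X, rotated]) auto
  then show ?case using insert by simp
qed simp

section \<open>Closure, cyclic sets and cyclic flats in terms of rank\<close>

definition cl :: "'e set \<Rightarrow> 'e set" where
  "cl X = {e \<in> E. rank (insert e X) = rank X}"

text \<open>Rank form of the absence of isthmuses in the restriction to \<open>X\<close>, by
  \<open>isthmus_restrict_iff\<close>.\<close>

definition cyclic :: "'e set \<Rightarrow> bool" where
  "cyclic X \<longleftrightarrow> (\<forall>e\<in>X. rank (X - {e}) = rank X)"

lemma cl_subset: "cl X \<subseteq> E"
  unfolding cl_def by auto

lemma subset_cl: "X \<subseteq> E \<Longrightarrow> X \<subseteq> cl X"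
  unfolding cl_def by (auto simp: insert_absorb)

lemma rank_cl: assumes "X \<subseteq> E" shows "rank (cl X) = rank X"
proof -
  have "rank (X \<union> cl X) = rank X"
    using finite_ground cl_subset by (intro rank_Un_eq) (auto simp: cl_def intro: finite_subset)
  then show ?thesis using subset_cl[OF assms] by (simp add: Un_absorb1)
qed

lemma matroid_basis_restrict_iff:
  "matroid_basis (restrict_indep indep X) B \<longleftrightarrow> B \<subseteq> X \<and> indep B \<and> card B = rank X" (is "?l \<longleftrightarrow> ?r")
proof
  assume l: ?l
  then have B: "B \<subseteq> X" "indep B" unfolding matroid_basis_def restrict_indep_def by auto
  obtain D where "B \<subseteq> D" "D \<subseteq> X" "indep D" "card D = rank X" using extend_to_rank B by blast
  then show ?r using l B unfolding matroid_basis_def restrict_indep_def by blast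
next
  assume r: ?r
  have "Y = B" if "Y \<subseteq> X" "indep Y" "B \<subseteq> Y" for Y
    using that r rank_ge[of Y X] card_seteq[of Y B] finite_indep by auto
  then show ?l using r unfolding matroid_basis_def restrict_indep_def by blast
qed

lemma isthmus_restrict_iff:
  "isthmus X (restrict_indep indep X) e \<longleftrightarrow> e \<in> X \<and> rank (X - {e}) \<noteq> rank X"
proof -
  have "(\<exists>B. B \<subseteq> X \<and> indep B \<and> card B = rank X \<and> e \<notin> B) \<longleftrightarrow> rank (X - {e}) = rank X" (is "?l \<longleftrightarrow> ?r")
  proof
    assume ?l
    then obtain B where B: "B \<subseteq> X - {e}" "indep B" "card B = rank X" by blast
    then show ?r using rank_ge[OF B(2,1)] rank_mono[OF Diff_subset, of X "{e}"] by simp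
  next
    assume ?r
    then show ?l using rank_witness[of "X - {e}"] by (metis subset_Diff_insert Diff_empty)
  qed
  then show ?thesis unfolding isthmus_def matroid_basis_restrict_iff by blast
qed

lemma cyclic_flat_iff:
  "cyclic_flat E indep X \<longleftrightarrow> X \<subseteq> E \<and> cl X = X \<and> cyclic X"
proof -
  have "rank X < rank (insert e X) \<longleftrightarrow> rank (insert e X) \<noteq> rank X" for e
    using rank_mono[OF subset_insertI, of X e] by auto
  then have "flat E indep X \<longleftrightarrow> X \<subseteq> E \<and> cl X = X"
    unfolding flat_def cl_def by (auto simp: insert_absorb)
  then show ?thesis unfolding cyclic_flat_def isthmus_restrict_iff cyclic_def by auto
qed

lemma cyclic_flatD:
  assumes "cyclic_flat E indep X"
  shows "X \<subseteq> E" "cl X = X" "cyclic X"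
  using assms cyclic_flat_iff by auto

text \<open>The element \<open>e\<close> is spanned by \<open>X - {e}\<close>, hence by the larger
  set \<open>Y - {e}\<close>. A union of cyclic sets is therefore cyclic.\<close>

lemma rank_Diff_eq_mono:
  assumes "X \<subseteq> Y" "e \<in> X" "rank (X - {e}) = rank X"
  shows "rank (Y - {e}) = rank Y"
proof -
  have "insert e (X - {e}) = X" "insert e (Y - {e}) = Y" "X - {e} \<subseteq> Y - {e}" using assms by auto
  then show ?thesis using rank_insert_eq_mono[of "X - {e}" "Y - {e}" e] assms(3) by simp
qed

lemma cyclic_Un: "cyclic X \<Longrightarrow> cyclic Y \<Longrightarrow> cyclic (X \<union> Y)"
  unfolding cyclic_def
  using rank_Diff_eq_mono[of X "X \<union> Y"] rank_Diff_eq_mono[of Y "X \<union> Y"] by auto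

lemma cl_cl: "X \<subseteq> E \<Longrightarrow> cl (cl X) = cl X"
proof
  assume X: "X \<subseteq> E"
  show "cl X \<subseteq> cl (cl X)" using cl_subset by (rule subset_cl)
  show "cl (cl X) \<subseteq> cl X"
  proof
    fix e assume e: "e \<in> cl (cl X)"
    then have "rank (insert e (cl X)) = rank X" using rank_cl[OF X] unfolding cl_def by auto
    moreover have "rank (insert e X) \<le> rank (insert e (cl X))"
      using subset_cl[OF X] by (intro rank_mono) auto
    ultimately have "rank (insert e X) = rank X" using rank_mono[OF subset_insertI, of X e] by simp
    then show "e \<in> cl X" using e unfolding cl_def by auto
  qed
qed

text \<open>An element that the closure adds to \<open>X\<close> is no isthmus, because
  \<open>X\<close> survives its deletion and already has full rank.\<close>

lemma cyclic_flat_cl: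
  assumes X: "X \<subseteq> E" "cyclic X"
  shows "cyclic_flat E indep (cl X)"
proof -
  have "rank (cl X - {e}) = rank (cl X)" if e: "e \<in> cl X" for e
  proof (cases "e \<in> X")
    case True
    then show ?thesis using X(2) rank_Diff_eq_mono[OF subset_cl[OF X(1)]]
      unfolding cyclic_def by simp
  next
    case False
    then have "rank X \<le> rank (cl X - {e})" using subset_cl[OF X(1)] by (intro rank_mono) auto
    moreover have "rank (cl X - {e}) \<le> rank (cl X)" by (intro rank_mono) auto
    ultimately show ?thesis using rank_cl[OF X(1)] by simp
  qed
  then show ?thesis unfolding cyclic_flat_iff cyclic_def using cl_cl X cl_subset by auto
qed

text \<open>\<open>C\<close> is a dependent subset of least cardinality, that is, a circuit:
  deleting any element leaves an independent set of size \<open>card C - 1\<close>, which is also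
  the rank of \<open>C\<close>.\<close>

lemma dependent_contains_circuit:
  assumes "X \<subseteq> E" "\<not> indep X"
  obtains C where "C \<subseteq> X" "cyclic C" "card C = rank C + 1"
proof -
  have fin: "finite Y" if "Y \<subseteq> X" for Y
    using that assms finite_ground by (meson finite_subset)
  define P where "P Y \<longleftrightarrow> Y \<subseteq> X \<and> \<not> indep Y" for Y
  define C where "C = arg_min card P"
  have PX: "P X" unfolding P_def using assms by simp
  have C: "P C" unfolding C_def using PX by (rule arg_min_natI)
  have least: "card C \<le> card Y" if "P Y" for Y unfolding C_def using that by (rule arg_min_nat_le)
  have ind: "indep (C - {e})" if "e \<in> C" for e
  proof (rule ccontr)
    assume "\<not> indep (C - {e})"
    then have "P (C - {e})" using C unfolding P_def by auto
    then have "card C \<le> card (C - {e})" by (rule least)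
    then show False using that card_Diff1_less[of C e] C fin unfolding P_def by simp
  qed
  have finC: "finite C" using C fin P_def by auto
  have "C \<noteq> {}" using C indep_empty unfolding P_def by auto
  have lt: "rank C < card C"
    using C rank_le_card[OF finC] indep_iff_rank[OF finC] unfolding P_def by auto
  have del: "rank (C - {e}) = rank C \<and> card C = rank C + 1" if e: "e \<in> C" for e
  proof -
    have "rank (C - {e}) = card C - 1"
      using ind[OF e] indep_iff_rank[of "C - {e}"] finC e by simp
    moreover have "rank (C - {e}) \<le> rank C" by (intro rank_mono) auto
    ultimately show ?thesis using lt by linarith
  qed
  show ?thesis
    using that[of C] del C \<open>C \<noteq> {}\<close> unfolding P_def cyclic_def by blast
qed

section \<open>How many sets of a presentation meet a given set\<close>

lemma rank_le_card_hits:
  assumes "finite I" and pres: "\<And>X. indep X \<longleftrightarrow> X \<subseteq> E \<and> (\<exists>\<phi>. matches I A \<phi> X)"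
  shows "rank X \<le> card (hits I A X)"
proof -
  obtain B where B: "B \<subseteq> X" "indep B" "card B = rank X" by (rule rank_witness)
  obtain \<phi> where "matches I A \<phi> B" using B(2) pres by blast
  then have "card B \<le> card (hits I A B)" using matches_card_le assms(1) by blast
  also have "\<dots> \<le> card (hits I A X)" using assms(1) B(1) by (rule card_hits_mono)
  finally show ?thesis using B(3) by simp
qed

text \<open>If a proper subset \<open>Y\<close> of \<open>F\<close> attains the minimum in the defect formula, then every element
  of \<open>F - Y\<close> is an isthmus of \<open>F\<close>.\<close>

lemma card_hits_cyclic_le:
  assumes "finite I" and pres: "\<And>X. indep X \<longleftrightarrow> X \<subseteq> E \<and> (\<exists>\<phi>. matches I A \<phi> X)"
    and F: "F \<subseteq> E" "cyclic F"
  shows "card (hits I A F) \<le> rank F"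
proof -
  have finF: "finite F" using F(1) finite_ground by (rule finite_subset)
  obtain B Y \<phi> where BY: "B \<subseteq> F" "Y \<subseteq> F" "matches I A \<phi> B"
    "card (F - Y) + card (hits I A Y) \<le> card B"
    using Hall_defect[OF finF assms(1)] by blast
  have "indep B" using BY F pres by blast
  then have le: "card (F - Y) + card (hits I A Y) \<le> rank F"
    using BY(1,4) rank_ge[of B F] by simp
  have "Y = F"
  proof (rule ccontr)
    assume "Y \<noteq> F"
    then obtain e where e: "e \<in> F - Y" using BY by blast
    \<comment> \<open>A basis of \<open>F\<close> that avoids \<open>e\<close>. It has at most
      \<open>card (hits I A Y)\<close> elements in \<open>Y\<close>, and fewer than
      \<open>card (F - Y)\<close> outside, which is too few by \<open>le\<close>.\<close>
    obtain D where D: "D \<subseteq> F - {e}" "indep D" "card D = rank (F - {e})" by (rule rank_witness)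
    have "rank (F - {e}) = rank F" using F(2) e unfolding cyclic_def by blast
    then have cD: "card D = rank F" using D(3) by simp
    have "indep (D \<inter> Y)" using indep_subset[OF D(2)] by blast
    then have "card (D \<inter> Y) \<le> card (hits I A (D \<inter> Y))"
      using pres matches_card_le[OF assms(1)] by blast
    also have "\<dots> \<le> card (hits I A Y)" using assms(1) by (rule card_hits_mono) blast
    finally have 1: "card (D \<inter> Y) \<le> card (hits I A Y)" .
    have "D - Y \<subset> F - Y" using D(1) e by blast
    then have 2: "card (D - Y) < card (F - Y)" using finF by (intro psubset_card_mono) simp_all
    have "card D = card (D \<inter> Y) + card (D - Y)"
      using finite_indep[OF D(2)] by (rule card_Int_Diff)
    then show False using 1 2 le cD by linarith
  qed
  then show ?thesis using le by simp
qed

section \<open>Contraction\<close>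

text \<open>Independence in the contraction \<open>M / b\<close>: the rank of
  \<open>X \<union> b\<close> is as large as possible. This form depends on no choice of a basis of
  \<open>b\<close>.\<close>

definition contract :: "'e set \<Rightarrow> 'e set \<Rightarrow> bool" where
  "contract b X \<longleftrightarrow> X \<subseteq> E - b \<and> rank (X \<union> b) = card X + rank b"

text \<open>\<open>B\<close> spans \<open>b\<close>, so \<open>X \<union> B\<close> and
  \<open>X \<union> b\<close> have the same rank. This reduces the matroid axioms of the contraction
  to those of \<open>M\<close>.\<close>

lemma contract_iff_indep_Un:
  assumes b: "b \<subseteq> E" and B: "B \<subseteq> b" "indep B" "card B = rank b"
  shows "contract b X \<longleftrightarrow> X \<subseteq> E - b \<and> indep (X \<union> B)"
proof (cases "X \<subseteq> E - b")
  case True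
  have fin: "finite X" "finite B" "finite b"
    using True b finite_indep[OF B(2)] finite_ground by (auto intro: finite_subset)
  have "rank (insert e (X \<union> B)) = rank (X \<union> B)" if "e \<in> b" for e
  proof (rule rank_insert_eq_mono[of B])
    have "rank (insert e B) \<le> rank b" using that B(1) by (intro rank_mono) auto
    then show "rank (insert e B) = rank B"
      using B indep_iff_rank[OF fin(2)] rank_mono[OF subset_insertI, of B e] by simp
  qed auto
  then have "rank (X \<union> B \<union> b) = rank (X \<union> B)" by (rule rank_Un_eq[OF fin(3)])
  moreover have "X \<union> B \<union> b = X \<union> b" using B(1) by auto
  moreover have "card (X \<union> B) = card X + rank b"
    using B True fin by (subst card_Un_disjoint) auto
  ultimately show ?thesis
    using True fin indep_iff_rank[of "X \<union> B"] unfolding contract_def by simp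
qed (simp add: contract_def)

lemma matroid_contract:
  assumes "b \<subseteq> E" shows "matroid (E - b) (contract b)"
proof -
  obtain B where B: "B \<subseteq> b" "indep B" "card B = rank b" by (rule rank_witness)
  note iff = contract_iff_indep_Un[OF assms B]
  show ?thesis
  proof
    show "finite (E - b)" using finite_ground by simp
    show "contract b {}" using B iff by simp
    show "X \<subseteq> E - b" if "contract b X" for X using that iff by simp
    show "contract b Y" if "contract b X" "Y \<subseteq> X" for X Y
      using that iff indep_subset[of "X \<union> B" "Y \<union> B"] by blast
    show "\<exists>x\<in>X - Y. contract b (insert x Y)"
      if X: "contract b X" and Y: "contract b Y" and c: "card X = card Y + 1" for X Y
    proof -
      have XY: "X \<subseteq> E - b" "Y \<subseteq> E - b" "indep (X \<union> B)" "indep (Y \<union> B)" using X Y iff by auto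
      have fin: "finite X" "finite Y" "finite B" using XY finite_indep by auto
      have "card (X \<union> B) = card X + card B" "card (Y \<union> B) = card Y + card B"
        using XY fin B(1) by (auto intro!: card_Un_disjoint)
      then obtain x where x: "x \<in> (X \<union> B) - (Y \<union> B)" "indep (insert x (Y \<union> B))"
        using augment[OF XY(3,4)] c by auto
      then have "contract b (insert x Y)" using XY iff by auto
      then show ?thesis using x by blast
    qed
  qed
qed

lemma rank_contract:
  assumes b: "b \<subseteq> E" and X: "X \<subseteq> E - b"
  shows "matroid_rank (contract b) X + rank b = rank (X \<union> b)"
proof (rule antisym)
  interpret N: matroid "E - b" "contract b" using b by (rule matroid_contract)
  obtain Y where Y: "Y \<subseteq> X" "contract b Y" "card Y = matroid_rank (contract b) X"
    by (rule N.rank_witness)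
  then have "matroid_rank (contract b) X + rank b = rank (Y \<union> b)" unfolding contract_def by simp
  also have "\<dots> \<le> rank (X \<union> b)" using Y(1) by (intro rank_mono) auto
  finally show "matroid_rank (contract b) X + rank b \<le> rank (X \<union> b)" .
  obtain B where B: "B \<subseteq> b" "indep B" "card B = rank b" by (rule rank_witness)
  obtain D where D: "B \<subseteq> D" "D \<subseteq> X \<union> b" "indep D" "card D = rank (X \<union> b)"
    using extend_to_rank[of B "X \<union> b"] B by blast
  have fin: "finite D" "finite B" using D(3) B(2) finite_indep by auto
  \<comment> \<open>\<open>B\<close> is already a basis of \<open>b\<close>, so its extension
    \<open>D\<close> contains no further element of \<open>b\<close>; the rest of \<open>D\<close>
    is then independent in the contraction.\<close>
  have "card (D \<inter> b) \<le> rank b" using indep_subset[OF D(3)] by (intro rank_ge) auto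
  then have "D \<inter> b = B" using B D(1) fin by (intro card_seteq[symmetric]) auto
  then have eq: "D - b \<union> B = D" "card D = card B + card (D - b)"
    using card_Int_Diff[OF fin(1), of b] by auto
  have "contract b (D - b)"
    unfolding contract_iff_indep_Un[OF b B] eq using D(2,3) X by auto
  then have "card (D - b) \<le> matroid_rank (contract b) X" using D(2) by (intro N.rank_ge) auto
  then show "rank (X \<union> b) \<le> matroid_rank (contract b) X + rank b" using eq D(4) B(3) by simp
qed

text \<open>Deleting an element of \<open>X\<close> preserves the rank in the contraction exactly
  when it preserves the rank of \<open>X \<union> b\<close>. The elements of \<open>b\<close> are no
  isthmuses of \<open>X \<union> b\<close> because \<open>b\<close> is cyclic.\<close>

lemma cyclic_contract_iff:
  assumes b: "b \<subseteq> E" "cyclic b" and X: "X \<subseteq> E - b"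
  shows "matroid.cyclic (contract b) X \<longleftrightarrow> cyclic (X \<union> b)"
proof -
  interpret N: matroid "E - b" "contract b" using b(1) by (rule matroid_contract)
  have "N.rank (X - {e}) = N.rank X \<longleftrightarrow> rank (X \<union> b - {e}) = rank (X \<union> b)" if "e \<in> X" for e
  proof -
    have eq: "X - {e} \<union> b = X \<union> b - {e}" and sub: "X - {e} \<subseteq> E - b" using that X by auto
    show ?thesis using rank_contract[OF b(1) X] rank_contract[OF b(1) sub] unfolding eq by linarith
  qed
  moreover have "rank (X \<union> b - {e}) = rank (X \<union> b)" if "e \<in> b" for e
    using rank_Diff_eq_mono[of b "X \<union> b" e] that b(2) unfolding cyclic_def by simp
  ultimately show ?thesis unfolding N.cyclic_def cyclic_def by blast
qed

text \<open>The closure of \<open>X\<close> in the contraction is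
  \<open>cl (X \<union> b) - b\<close>. The cyclic flats of the contraction are thus the sets
  \<open>F - b\<close> for cyclic flats \<open>F\<close> of \<open>M\<close> containing
  \<open>b\<close>.\<close>

lemma cyclic_flat_contract_iff:
  assumes b: "cyclic_flat E indep b" and X: "X \<subseteq> E - b"
  shows "cyclic_flat (E - b) (contract b) X \<longleftrightarrow> cyclic_flat E indep (X \<union> b)"
proof -
  note bD = cyclic_flatD[OF b]
  interpret N: matroid "E - b" "contract b" using bD(1) by (rule matroid_contract)
  have "N.rank (insert e X) = N.rank X \<longleftrightarrow> rank (insert e (X \<union> b)) = rank (X \<union> b)"
    if "e \<in> E - b" for e
  proof -
    have "insert e X \<subseteq> E - b" using X that by blast
    from rank_contract[OF bD(1) X] rank_contract[OF bD(1) this] show ?thesis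
      unfolding Un_insert_left by linarith
  qed
  then have "N.cl X = cl (X \<union> b) - b" unfolding N.cl_def cl_def by blast
  moreover have "X \<union> b \<subseteq> cl (X \<union> b)" using X bD(1) by (intro subset_cl) auto
  ultimately have "N.cl X = X \<longleftrightarrow> cl (X \<union> b) = X \<union> b" using X by blast
  then show ?thesis
    unfolding N.cyclic_flat_iff cyclic_flat_iff cyclic_contract_iff[OF bD(1,3) X]
    using X bD(1) by auto
qed

text \<open>Restates a presentation of the contraction as inequalities between ranks of
  \<open>M\<close>. For a cyclic \<open>F\<close> containing \<open>b\<close> the two bounds agree:
  exactly \<open>rank F - rank b\<close> sets of the presentation meet \<open>F\<close>.\<close>

lemma transversal_contractE:
  assumes b: "cyclic_flat E indep b" and tr: "transversal_matroid (E - b) (contract b)"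
  obtains r :: nat and A where "\<And>j. j < r \<Longrightarrow> A j \<subseteq> E - b"
    "\<And>Y. Y \<subseteq> E \<Longrightarrow> rank (Y \<union> b) \<le> card (hits {..<r} A Y) + rank b"
    "\<And>F. F \<subseteq> E \<Longrightarrow> cyclic F \<Longrightarrow> b \<subseteq> F \<Longrightarrow> card (hits {..<r} A F) + rank b \<le> rank F"
proof -
  note bD = cyclic_flatD[OF b]
  interpret N: matroid "E - b" "contract b" using bD(1) by (rule matroid_contract)
  obtain r :: nat and A where A: "\<And>j. j < r \<Longrightarrow> A j \<subseteq> E - b"
    and pres: "\<And>X. contract b X \<longleftrightarrow> X \<subseteq> E - b \<and> (\<exists>\<phi>. matches {..<r} A \<phi> X)"
    using transversal_matroidE[OF tr] by blast
  have hits: "hits {..<r} A (Y - b) = hits {..<r} A Y" for Y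
    using A unfolding hits_def by fastforce
  have "rank (Y \<union> b) \<le> card (hits {..<r} A Y) + rank b" if "Y \<subseteq> E" for Y
  proof -
    have "N.rank (Y - b) + rank b = rank (Y \<union> b)"
      using rank_contract[OF bD(1), of "Y - b"] that by auto
    moreover have "N.rank (Y - b) \<le> card (hits {..<r} A (Y - b))"
      by (rule N.rank_le_card_hits[OF _ pres]) simp
    ultimately show ?thesis unfolding hits by simp
  qed
  moreover have "card (hits {..<r} A F) + rank b \<le> rank F"
    if F: "F \<subseteq> E" "cyclic F" "b \<subseteq> F" for F
  proof -
    have sub: "F - b \<subseteq> E - b" and eq: "F - b \<union> b = F" using F by auto
    have "N.cyclic (F - b)" using cyclic_contract_iff[OF bD(1,3) sub] F(2) eq by simp
    then have "card (hits {..<r} A (F - b)) \<le> N.rank (F - b)"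
      by (intro N.card_hits_cyclic_le[OF _ pres] sub) simp_all
    then show ?thesis using rank_contract[OF bD(1) sub] unfolding eq hits by simp
  qed
  ultimately show ?thesis using that A by blast
qed

section \<open>Combining the presentations of two contractions\<close>

text \<open>The shape of the lattice enters through \<open>top\<close>, \<open>cover\<close> and
  \<open>join\<close>. The cases \<open>b1 = T\<close> and \<open>b2 = T\<close> are included and
  serve trivial factors.\<close>

theorem transversal_of_contractions:
  assumes T: "cyclic_flat E indep T"
    and b1: "cyclic_flat E indep b1" "b1 \<subseteq> T" and b2: "cyclic_flat E indep b2" "b2 \<subseteq> T"
    and top: "\<And>F. cyclic_flat E indep F \<Longrightarrow> F \<subseteq> T"
    and cover: "\<And>F. cyclic_flat E indep F \<Longrightarrow> F = cl {} \<or> b1 \<subseteq> F \<or> b2 \<subseteq> F"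
    and join: "rank (b1 \<union> b2) = rank T"
    and tr1: "transversal_matroid (E - b1) (contract b1)"
    and tr2: "transversal_matroid (E - b2) (contract b2)"
  shows "transversal_matroid E indep"
proof -
  obtain r1 :: nat and A1 where A1: "\<And>j. j < r1 \<Longrightarrow> A1 j \<subseteq> E - b1"
    "\<And>Y. Y \<subseteq> E \<Longrightarrow> rank (Y \<union> b1) \<le> card (hits {..<r1} A1 Y) + rank b1"
    "\<And>F. F \<subseteq> E \<Longrightarrow> cyclic F \<Longrightarrow> b1 \<subseteq> F \<Longrightarrow> card (hits {..<r1} A1 F) + rank b1 \<le> rank F"
    using transversal_contractE[OF b1(1) tr1] by blast
  obtain r2 :: nat and A2 where A2: "\<And>j. j < r2 \<Longrightarrow> A2 j \<subseteq> E - b2"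
    "\<And>Y. Y \<subseteq> E \<Longrightarrow> rank (Y \<union> b2) \<le> card (hits {..<r2} A2 Y) + rank b2"
    "\<And>F. F \<subseteq> E \<Longrightarrow> cyclic F \<Longrightarrow> b2 \<subseteq> F \<Longrightarrow> card (hits {..<r2} A2 F) + rank b2 \<le> rank F"
    using transversal_contractE[OF b2(1) tr2] by blast
  note TD = cyclic_flatD[OF T] and b1D = cyclic_flatD[OF b1(1)] and b2D = cyclic_flatD[OF b2(1)]
  define n1 where "n1 Y = card (hits {..<r1} A1 Y)" for Y
  define n2 where "n2 Y = card (hits {..<r2} A2 Y)" for Y
  have n_mono: "n1 Y \<le> n1 Z" "n2 Y \<le> n2 Z" if "Y \<subseteq> Z" for Y Z
    unfolding n1_def n2_def using that by (auto intro: card_hits_mono)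
  define k where "k = rank b1 + rank b2 - rank T"
  \<comment> \<open>Submodularity shows that the subtraction in \<open>k\<close> does not
    truncate.\<close>
  have k: "k + rank T = rank b1 + rank b2"
    using rank_submodular[of b1 b2] join unfolding k_def by simp
  define I :: "(nat + nat + nat + 'e) set"
    where "I = {..<r1} <+> {..<r2} <+> {..<k} <+> (E - T)"
  \<comment> \<open>Every cyclic flat lies in \<open>T\<close>, so the elements outside
    \<open>T\<close> are isthmuses: each gets its own singleton and is removed from the other sets.
    Loops must lie in no set; \<open>A1\<close> and \<open>A2\<close> avoid them because they avoid
    \<open>b1\<close> and \<open>b2\<close>.\<close>
  define A :: "nat + nat + nat + 'e \<Rightarrow> 'e set"
    where "A = case_sum (\<lambda>j. A1 j \<inter> T) (case_sum (\<lambda>j. A2 j \<inter> T)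
                 (case_sum (\<lambda>_. T - cl {}) (\<lambda>e. {e})))"
  have finI: "finite I" unfolding I_def using finite_ground by simp
  have hits: "hits I A Y = hits {..<r1} A1 (Y \<inter> T) <+> hits {..<r2} A2 (Y \<inter> T) <+>
      (if Y \<inter> T \<subseteq> cl {} then {} else {..<k}) <+> (Y - T)" if "Y \<subseteq> E" for Y
  proof -
    have "hits {..<k} (\<lambda>_. T - cl {}) Y = (if Y \<inter> T \<subseteq> cl {} then {} else {..<k})"
      "hits (E - T) (\<lambda>e. {e}) Y = Y - T"
      "hits {..<r1} (\<lambda>j. A1 j \<inter> T) Y = hits {..<r1} A1 (Y \<inter> T)"
      "hits {..<r2} (\<lambda>j. A2 j \<inter> T) Y = hits {..<r2} A2 (Y \<inter> T)"
      using that unfolding hits_def by auto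
    then show ?thesis unfolding I_def A_def hits_Plus by simp
  qed
  have card_hits: "card (hits I A Y) = n1 (Y \<inter> T) + n2 (Y \<inter> T) +
      (if Y \<inter> T \<subseteq> cl {} then 0 else k) + card (Y - T)" if "Y \<subseteq> E" for Y
  proof -
    have "finite (Y - T)" using that finite_ground by (auto intro: finite_subset)
    then show ?thesis
      unfolding hits[OF that] n1_def n2_def by (simp add: card_Plus finite_hits)
  qed
  have Hall_of_indep: "card Y \<le> card (hits I A Y)" if Y: "indep Y" for Y
  proof -
    define Z where "Z = Y \<inter> T"
    have finY: "finite Y" and YE: "Y \<subseteq> E" using Y finite_indep indep_subset_ground by auto
    have "card Z \<le> n1 Z + n2 Z + (if Z \<subseteq> cl {} then 0 else k)"
    proof (cases "Z = {}")
      case False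
      have ZE: "Z \<subseteq> E" using YE Z_def by auto
      have Z: "indep Z" "finite Z" using indep_subset[OF Y, of Z] finY Z_def by auto
      obtain z where z: "z \<in> Z" using False by blast
      \<comment> \<open>An element of an independent set is no loop, so \<open>Z\<close> meets all
        \<open>k\<close> additional sets.\<close>
      have "rank {z} = 1" "rank {} = 0"
        using indep_subset[OF Z(1), of "{z}"] z indep_iff_rank[of "{z}"] rank_le_card[of "{}"]
        by auto
      then have "\<not> Z \<subseteq> cl {}" using z unfolding cl_def by auto
      \<comment> \<open>The union of \<open>Z \<union> b1\<close> and \<open>Z \<union> b2\<close>
        has rank at least \<open>rank T\<close>, and their intersection contains \<open>Z\<close>.
        With the lower bounds on \<open>n1 Z\<close> and \<open>n2 Z\<close>, the value of
        \<open>k\<close> supplies exactly what is missing to \<open>card Z\<close>.\<close>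
      moreover have "rank T + rank Z \<le> rank (Z \<union> b1) + rank (Z \<union> b2)"
      proof -
        have "rank T \<le> rank (Z \<union> b1 \<union> (Z \<union> b2))" unfolding join[symmetric] by (intro rank_mono) auto
        moreover have "rank Z \<le> rank ((Z \<union> b1) \<inter> (Z \<union> b2))" by (intro rank_mono) auto
        ultimately show ?thesis using rank_submodular[of "Z \<union> b1" "Z \<union> b2"] by linarith
      qed
      ultimately show ?thesis
        using A1(2)[OF ZE] A2(2)[OF ZE] k indep_iff_rank[OF Z(2)] Z(1)
        unfolding n1_def n2_def by simp
    qed simp
    moreover have "card Y = card Z + card (Y - T)" unfolding Z_def using finY by (rule card_Int_Diff)
    ultimately show ?thesis unfolding card_hits[OF YE] Z_def by simp
  qed
  have indep_of_Hall: "indep X" if X: "X \<subseteq> E" and Hall: "\<And>Y. Y \<subseteq> X \<Longrightarrow> card Y \<le> card (hits I A Y)" for X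
  proof (rule ccontr)
    assume "\<not> indep X"
    then obtain C where C: "C \<subseteq> X" "cyclic C" "card C = rank C + 1"
      using dependent_contains_circuit[OF X] by blast
    define F where "F = cl C"
    have CE: "C \<subseteq> E" using C X by blast
    have F: "cyclic_flat E indep F" unfolding F_def using CE C(2) by (rule cyclic_flat_cl)
    note FD = cyclic_flatD[OF F]
    have CF: "C \<subseteq> F" unfolding F_def using CE by (rule subset_cl)
    have cC: "card C = rank F + 1" using C(3) rank_cl[OF CE] unfolding F_def by simp
    have FT: "F \<subseteq> T" using F by (rule top)
    then have CT: "C \<inter> T = C" "C - T = {}" using CF by auto
    have le: "rank F + 1 \<le> n1 C + n2 C + (if C \<subseteq> cl {} then 0 else k)"
      using Hall[OF C(1)] unfolding card_hits[OF CE] CT cC by simp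
    have nT: "n1 C + rank b1 \<le> rank T" "n2 C + rank b2 \<le> rank T"
      using A1(3)[OF TD(1,3) b1(2)] A2(3)[OF TD(1,3) b2(2)] n_mono[of C T] CT(1)
      unfolding n1_def n2_def by fastforce+
    \<comment> \<open>Otherwise \<open>C\<close> consists of loops, which lie in \<open>b1\<close>
      and in \<open>b2\<close>, so \<open>C\<close> meets no set of the family.\<close>
    have "F \<noteq> cl {}"
    proof
      assume loops: "F = cl {}"
      have "cl {} \<subseteq> b" if "cl b = b" for b
        using rank_insert_eq_mono[of "{}" b] that unfolding cl_def by blast
      from this[OF b1D(2)] this[OF b2D(2)] have "C \<subseteq> b1" "C \<subseteq> b2" using CF loops by auto
      then have "hits {..<r1} A1 C = {}" "hits {..<r2} A2 C = {}"
        using A1(1) A2(1) unfolding hits_def by fastforce+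
      then show False using le CF loops unfolding n1_def n2_def by simp
    qed
    moreover have "\<not> b1 \<subseteq> F"
    proof
      assume "b1 \<subseteq> F"
      then have "n1 C + rank b1 \<le> rank F"
        using A1(3)[OF FD(1,3)] n_mono(1)[OF CF] unfolding n1_def by fastforce
      \<comment> \<open>The three bounds \<open>rank F - rank b1\<close>,
        \<open>rank T - rank b2\<close> and \<open>k\<close> add up to \<open>rank F\<close>, one
        less than \<open>card C\<close>.\<close>
      then show False using le nT(2) k by (simp split: if_splits)
    qed
    moreover have "\<not> b2 \<subseteq> F"
    proof
      assume "b2 \<subseteq> F"
      then have "n2 C + rank b2 \<le> rank F"
        using A2(3)[OF FD(1,3)] n_mono(2)[OF CF] unfolding n2_def by fastforce
      then show False using le nT(1) k by (simp split: if_splits)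
    qed
    ultimately show False using cover[OF F] by blast
  qed
  have "indep X \<longleftrightarrow> X \<subseteq> E \<and> (\<exists>\<phi>. matches I A \<phi> X)" for X
  proof (cases "X \<subseteq> E")
    case True
    have finX: "finite X" using True finite_ground by (rule finite_subset)
    show ?thesis unfolding matches_iff_Hall[OF finX finI]
      using True indep_of_Hall[OF True] Hall_of_indep indep_subset by blast
  next
    case False
    then show ?thesis using indep_subset_ground by blast
  qed
  moreover have "A i \<subseteq> E" if "i \<in> I" for i
    using that TD(1) unfolding I_def A_def by auto
  ultimately show ?thesis using transversal_matroidI[OF matroid_axioms finI] by blast
qed

end

text \<open>Adding \<open>b\<close> carries the cyclic flats of the contraction to those of
  \<open>M\<close> above \<open>b\<close>, and \<open>h\<close> carries these to the up-set of
  \<open>h b\<close> in \<open>K\<close>. The map \<open>g\<close> is a parameter because in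
  \<open>L1 * L2\<close> this up-set is only a renamed copy of the factor.\<close>

lemma (in matroid) order_isomorphic_contract:
  assumes b: "cyclic_flat E indep b"
    and h: "order_emb (cyclic_flats E indep) K h" "bij_betw h {X. cyclic_flat E indep X} (carrier K)"
    and L: "weak_partial_order L"
    and g: "bij_betw g {s \<in> carrier K. h b \<sqsubseteq>\<^bsub>K\<^esub> s} (carrier L)"
    and g_le: "\<And>s s'. \<lbrakk>s \<in> carrier K; h b \<sqsubseteq>\<^bsub>K\<^esub> s; s' \<in> carrier K; h b \<sqsubseteq>\<^bsub>K\<^esub> s'\<rbrakk>
      \<Longrightarrow> g s \<sqsubseteq>\<^bsub>L\<^esub> g s' \<longleftrightarrow> s \<sqsubseteq>\<^bsub>K\<^esub> s'"
  shows "order_isomorphic (cyclic_flats (E - b) (contract b)) L"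
proof -
  have h_le: "h X \<sqsubseteq>\<^bsub>K\<^esub> h Y \<longleftrightarrow> X \<subseteq> Y" if "cyclic_flat E indep X" "cyclic_flat E indep Y" for X Y
    using h(1) that unfolding order_emb_def cyclic_flats_def by simp
  have h_in: "h X \<in> carrier K" if "cyclic_flat E indep X" for X
    using h(2) that by (auto dest: bij_betwE)
  let ?Z = "{X. cyclic_flat (E - b) (contract b) X}"
  have ground: "X \<subseteq> E - b" if "X \<in> ?Z" for X
    using that unfolding cyclic_flat_def flat_def by simp
  have flat: "cyclic_flat E indep (X \<union> b)" if "X \<in> ?Z" for X
    using that cyclic_flat_contract_iff[OF b ground[OF that]] by simp
  have bij1: "bij_betw (\<lambda>X. X \<union> b) ?Z {F. cyclic_flat E indep F \<and> b \<subseteq> F}"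
  proof (rule bij_betw_byWitness[where f' = "\<lambda>F. F - b"])
    show "\<forall>X\<in>?Z. X \<union> b - b = X" using ground by blast
    show "\<forall>F\<in>{F. cyclic_flat E indep F \<and> b \<subseteq> F}. F - b \<union> b = F" by blast
    show "(\<lambda>X. X \<union> b) ` ?Z \<subseteq> {F. cyclic_flat E indep F \<and> b \<subseteq> F}" using flat by blast
    show "(\<lambda>F. F - b) ` {F. cyclic_flat E indep F \<and> b \<subseteq> F} \<subseteq> ?Z"
    proof (rule image_subsetI)
      fix F assume F: "F \<in> {F. cyclic_flat E indep F \<and> b \<subseteq> F}"
      then have "F - b \<subseteq> E - b" "F - b \<union> b = F" using cyclic_flatD(1) by auto
      then show "F - b \<in> ?Z" using cyclic_flat_contract_iff[OF b, of "F - b"] F by simp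
    qed
  qed
  have bij2: "bij_betw h {F. cyclic_flat E indep F \<and> b \<subseteq> F} {s \<in> carrier K. h b \<sqsubseteq>\<^bsub>K\<^esub> s}"
  proof -
    have img: "carrier K = h ` {X. cyclic_flat E indep X}" using h(2) unfolding bij_betw_def by simp
    have "h ` {F. cyclic_flat E indep F \<and> b \<subseteq> F} = {s \<in> carrier K. h b \<sqsubseteq>\<^bsub>K\<^esub> s}"
      unfolding img using h_le[OF b] by auto
    then show ?thesis using h(2) unfolding bij_betw_def by (auto intro: inj_on_subset)
  qed
  have "bij_betw (g \<circ> (h \<circ> (\<lambda>X. X \<union> b))) ?Z (carrier L)"
    using bij_betw_trans[OF bij_betw_trans[OF bij1 bij2] g] .
  moreover have "order_emb (cyclic_flats (E - b) (contract b)) L (g \<circ> (h \<circ> (\<lambda>X. X \<union> b)))"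
  proof -
    have "weak_partial_order (cyclic_flats (E - b) (contract b))"
      unfolding cyclic_flats_def by unfold_locales auto
    moreover have "g (h (X \<union> b)) \<sqsubseteq>\<^bsub>L\<^esub> g (h (Y \<union> b)) \<longleftrightarrow> X \<subseteq> Y" if XY: "X \<in> ?Z" "Y \<in> ?Z" for X Y
    proof -
      have "X \<union> b \<subseteq> Y \<union> b \<longleftrightarrow> X \<subseteq> Y" using ground XY by blast
      then show ?thesis
        using g_le[of "h (X \<union> b)" "h (Y \<union> b)"] h_le[OF flat flat, OF XY] h_le[OF b flat] h_in[OF flat] XY
        by simp
    qed
    ultimately show ?thesis unfolding order_emb_def using L by (simp add: cyclic_flats_def)
  qed
  ultimately show ?thesis unfolding order_isomorphic_def by (auto simp: cyclic_flats_def)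
qed

section \<open>The lattice \<open>L1 * L2\<close>\<close>

text \<open>The top is defined by choice, so a greatest element has to be exhibited first: the join
  of the finite nonempty carrier.\<close>

lemma finite_lattice_top:
  assumes "finite_lattice L"
  shows "\<top>\<^bsub>L\<^esub> \<in> carrier L" "\<And>x. x \<in> carrier L \<Longrightarrow> x \<sqsubseteq>\<^bsub>L\<^esub> \<top>\<^bsub>L\<^esub>"
proof -
  interpret lattice L using assms unfolding finite_lattice_def by simp
  have "least L (\<Squnion>\<^bsub>L\<^esub>(carrier L)) (Upper L (carrier L))"
    using assms unfolding finite_lattice_def by (intro finite_sup_least) auto
  then have "greatest L (\<Squnion>\<^bsub>L\<^esub>(carrier L)) (carrier L)"
    unfolding least_def greatest_def Upper_def by auto
  then have "greatest L \<top>\<^bsub>L\<^esub> (carrier L)" unfolding top_def by (rule someI)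
  then show "\<top>\<^bsub>L\<^esub> \<in> carrier L" "\<And>x. x \<in> carrier L \<Longrightarrow> x \<sqsubseteq>\<^bsub>L\<^esub> \<top>\<^bsub>L\<^esub>"
    unfolding greatest_def by auto
qed

lemma finite_lattice_bottom:
  assumes "finite_lattice L"
  shows "\<bottom>\<^bsub>L\<^esub> \<in> carrier L" "\<And>x. x \<in> carrier L \<Longrightarrow> \<bottom>\<^bsub>L\<^esub> \<sqsubseteq>\<^bsub>L\<^esub> x"
proof -
  interpret lattice L using assms unfolding finite_lattice_def by simp
  have "greatest L (\<Sqinter>\<^bsub>L\<^esub>(carrier L)) (Lower L (carrier L))"
    using assms unfolding finite_lattice_def by (intro finite_inf_greatest) auto
  then have "least L (\<Sqinter>\<^bsub>L\<^esub>(carrier L)) (carrier L)"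
    unfolding least_def greatest_def Lower_def by auto
  then have "least L \<bottom>\<^bsub>L\<^esub> (carrier L)" unfolding bottom_def by (rule someI)
  then show "\<bottom>\<^bsub>L\<^esub> \<in> carrier L" "\<And>x. x \<in> carrier L \<Longrightarrow> \<bottom>\<^bsub>L\<^esub> \<sqsubseteq>\<^bsub>L\<^esub> x"
    unfolding least_def by auto
qed

text \<open>Together with \<open>swap\<close>, this transfers results on the \<open>L1\<close> part
  to the \<open>L2\<close> part.\<close>

lemma lattice_star_commute: "lattice_star z t L1 L2 = lattice_star z t L2 L1"
  unfolding lattice_star_def by (simp add: Un_ac insert_commute disj_ac)

locale star_pair =
  fixes L1 L2 :: "'a gorder" and z t :: 'a
  assumes L1: "finite_lattice L1" and L2: "finite_lattice L2"
    and disjoint: "carrier L1 \<inter> carrier L2 = {}"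
    and z_neq_t: "z \<noteq> t"
    and z_new: "z \<notin> carrier L1 \<union> carrier L2" and t_new: "t \<notin> carrier L1 \<union> carrier L2"
begin

abbreviation "S \<equiv> lattice_star z t L1 L2"

lemma swap: "star_pair L2 L1 z t"
  using L1 L2 disjoint z_neq_t z_new t_new by unfold_locales auto

lemma lattices: "lattice L1" "lattice L2"
  using L1 L2 unfolding finite_lattice_def by auto

lemma tops: "\<top>\<^bsub>L1\<^esub> \<in> carrier L1" "\<top>\<^bsub>L2\<^esub> \<in> carrier L2"
  using L1 L2 by (simp_all add: finite_lattice_top)

lemma carrier_S:
  "carrier S = (carrier L1 - {\<top>\<^bsub>L1\<^esub>}) \<union> (carrier L2 - {\<top>\<^bsub>L2\<^esub>}) \<union> {z, t}"
  using tops disjoint z_new t_new unfolding lattice_star_def by auto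

lemma eq_S: "eq S = (=)"
  unfolding lattice_star_def by simp

lemma le_S: "x \<sqsubseteq>\<^bsub>S\<^esub> y \<longleftrightarrow> y = t \<or> x = z \<or>
              (x \<in> carrier L1 \<and> y \<in> carrier L1 \<and> x \<sqsubseteq>\<^bsub>L1\<^esub> y) \<or>
              (x \<in> carrier L2 \<and> y \<in> carrier L2 \<and> x \<sqsubseteq>\<^bsub>L2\<^esub> y)"
  unfolding lattice_star_def by simp

lemma S_cases:
  assumes "x \<in> carrier S"
  obtains "x = z" | "x = t" | "x \<in> carrier L1" "x \<noteq> \<top>\<^bsub>L1\<^esub>" | "x \<in> carrier L2" "x \<noteq> \<top>\<^bsub>L2\<^esub>"
  using assms unfolding carrier_S by blast

lemma le_S_L1: "x \<in> carrier L1 \<Longrightarrow> x \<sqsubseteq>\<^bsub>S\<^esub> y \<longleftrightarrow> y = t \<or> y \<in> carrier L1 \<and> x \<sqsubseteq>\<^bsub>L1\<^esub> y"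
  using z_new disjoint unfolding le_S by auto

lemma le_S_L2: "x \<in> carrier L2 \<Longrightarrow> x \<sqsubseteq>\<^bsub>S\<^esub> y \<longleftrightarrow> y = t \<or> y \<in> carrier L2 \<and> x \<sqsubseteq>\<^bsub>L2\<^esub> y"
  using z_new disjoint unfolding le_S by auto

lemma bounds_S: "z \<sqsubseteq>\<^bsub>S\<^esub> x" "x \<sqsubseteq>\<^bsub>S\<^esub> t"
  unfolding le_S by simp_all

lemma le_S_t: "t \<sqsubseteq>\<^bsub>S\<^esub> y \<longleftrightarrow> y = t"
  using z_neq_t t_new unfolding le_S by auto

lemma antisym_S:
  assumes le: "x \<sqsubseteq>\<^bsub>S\<^esub> y" "y \<sqsubseteq>\<^bsub>S\<^esub> x" and x: "x \<in> carrier S"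
  shows "x = y"
proof -
  interpret A: lattice L1 by (rule lattices)
  interpret B: lattice L2 by (rule lattices)
  from x show ?thesis
    proof (cases rule: S_cases)
      case 1
      then show ?thesis using le(2) z_new z_neq_t unfolding le_S by auto
    next
      case 2
      then show ?thesis using le(1) le_S_t by simp
    next
      case 3
      then show ?thesis using le t_new le_S_L1[of x y] le_S_L1[of y x] le_S_t by auto
    next
      case 4
      then show ?thesis using le t_new le_S_L2[of x y] le_S_L2[of y x] le_S_t by auto
    qed
qed

lemma partial_order_S: "partial_order S"
proof -
  interpret A: lattice L1 by (rule lattices)
  interpret B: lattice L2 by (rule lattices)
  show ?thesis
  proof
    show "x \<sqsubseteq>\<^bsub>S\<^esub> x" if "x \<in> carrier S" for x
      using that by (cases rule: S_cases) (auto simp: le_S)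
    show "x .=\<^bsub>S\<^esub> y" if "x \<sqsubseteq>\<^bsub>S\<^esub> y" "y \<sqsubseteq>\<^bsub>S\<^esub> x" "x \<in> carrier S" for x y
      unfolding eq_S using that by (rule antisym_S)
    show "x \<sqsubseteq>\<^bsub>S\<^esub> w" if le: "x \<sqsubseteq>\<^bsub>S\<^esub> y" "y \<sqsubseteq>\<^bsub>S\<^esub> w" and x: "x \<in> carrier S" for x y w
      using x
    proof (cases rule: S_cases)
      case 1
      then show ?thesis unfolding le_S by simp
    next
      case 2
      then show ?thesis using le le_S_t by auto
    next
      case 3
      then show ?thesis
        using le le_S_L1[of x] le_S_L1[of y w] le_S_t[of w] A.le_trans[of x y w] by auto
    next
      case 4
      then show ?thesis
        using le le_S_L2[of x] le_S_L2[of y w] le_S_t[of w] B.le_trans[of x y w] by auto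
    qed
  qed (simp_all add: eq_S)
qed

text \<open>The join in \<open>L1\<close> serves unless it is the removed top. In that case an upper
  bound other than \<open>t\<close> would have to be the removed element, so \<open>t\<close> is the
  join.\<close>

lemma sup_S_L1:
  assumes x: "x \<in> carrier L1" and y: "y \<in> carrier L1"
  shows "\<exists>s\<in>carrier S. x \<sqsubseteq>\<^bsub>S\<^esub> s \<and> y \<sqsubseteq>\<^bsub>S\<^esub> s \<and>
    (\<forall>u\<in>carrier S. x \<sqsubseteq>\<^bsub>S\<^esub> u \<longrightarrow> y \<sqsubseteq>\<^bsub>S\<^esub> u \<longrightarrow> s \<sqsubseteq>\<^bsub>S\<^esub> u)"
proof -
  interpret A: lattice L1 by (rule lattices)
  define j where "j = x \<squnion>\<^bsub>L1\<^esub> y"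
  have j: "j \<in> carrier L1" "x \<sqsubseteq>\<^bsub>L1\<^esub> j" "y \<sqsubseteq>\<^bsub>L1\<^esub> j" unfolding j_def using x y
    by (auto intro: A.join_left A.join_right)
  have least: "j \<sqsubseteq>\<^bsub>L1\<^esub> u" if "u \<in> carrier L1" "x \<sqsubseteq>\<^bsub>L1\<^esub> u" "y \<sqsubseteq>\<^bsub>L1\<^esub> u" for u
    unfolding j_def using x y that by (intro A.join_le)
  show ?thesis
  proof (cases "j = \<top>\<^bsub>L1\<^esub>")
    case True
    have "u = t" if u: "u \<in> carrier S" "x \<sqsubseteq>\<^bsub>S\<^esub> u" "y \<sqsubseteq>\<^bsub>S\<^esub> u" for u
    proof (rule ccontr)
      assume "u \<noteq> t"
      then have "u \<in> carrier L1" "\<top>\<^bsub>L1\<^esub> \<sqsubseteq>\<^bsub>L1\<^esub> u"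
        using u le_S_L1[OF x] le_S_L1[OF y] least True by auto
      moreover from this have "u = \<top>\<^bsub>L1\<^esub>" using finite_lattice_top[OF L1] A.le_antisym by blast
      ultimately show False using u(1) disjoint z_new t_new unfolding carrier_S by auto
    qed
    moreover have "t \<in> carrier S" unfolding carrier_S by simp
    ultimately show ?thesis using bounds_S by metis
  next
    case False
    then show ?thesis
      using j least le_S_L1 x y by (intro bexI[of _ j]) (auto simp: carrier_S)
  qed
qed

text \<open>The meet in \<open>L1\<close> lies below \<open>x\<close>, which is not the top, so it
  is not the removed element.\<close>

lemma inf_S_L1:
  assumes x: "x \<in> carrier L1" "x \<noteq> \<top>\<^bsub>L1\<^esub>" and y: "y \<in> carrier L1"
  shows "\<exists>s\<in>carrier S. s \<sqsubseteq>\<^bsub>S\<^esub> x \<and> s \<sqsubseteq>\<^bsub>S\<^esub> y \<and>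
    (\<forall>u\<in>carrier S. u \<sqsubseteq>\<^bsub>S\<^esub> x \<longrightarrow> u \<sqsubseteq>\<^bsub>S\<^esub> y \<longrightarrow> u \<sqsubseteq>\<^bsub>S\<^esub> s)"
proof -
  interpret A: lattice L1 by (rule lattices)
  define m where "m = x \<sqinter>\<^bsub>L1\<^esub> y"
  have m: "m \<in> carrier L1" "m \<sqsubseteq>\<^bsub>L1\<^esub> x" "m \<sqsubseteq>\<^bsub>L1\<^esub> y" unfolding m_def using x(1) y
    by (auto intro: A.meet_left A.meet_right)
  have greatest: "u \<sqsubseteq>\<^bsub>L1\<^esub> m" if "u \<in> carrier L1" "u \<sqsubseteq>\<^bsub>L1\<^esub> x" "u \<sqsubseteq>\<^bsub>L1\<^esub> y" for u
    unfolding m_def using x(1) y that by (intro A.meet_le)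
  have "m \<noteq> \<top>\<^bsub>L1\<^esub>" using m x finite_lattice_top[OF L1] A.le_antisym by blast
  then have "m \<in> carrier S" using m(1) unfolding carrier_S by simp
  moreover have "u \<sqsubseteq>\<^bsub>S\<^esub> m" if u: "u \<sqsubseteq>\<^bsub>S\<^esub> x" "u \<sqsubseteq>\<^bsub>S\<^esub> y" for u
    using u x y m(1) greatest t_new disjoint unfolding le_S by blast
  ultimately show ?thesis using m x(1) y le_S_L1 by (intro bexI[of _ m]) auto
qed

lemma sup_S_L2:
  assumes "x \<in> carrier L2" "y \<in> carrier L2"
  shows "\<exists>s\<in>carrier S. x \<sqsubseteq>\<^bsub>S\<^esub> s \<and> y \<sqsubseteq>\<^bsub>S\<^esub> s \<and>
    (\<forall>u\<in>carrier S. x \<sqsubseteq>\<^bsub>S\<^esub> u \<longrightarrow> y \<sqsubseteq>\<^bsub>S\<^esub> u \<longrightarrow> s \<sqsubseteq>\<^bsub>S\<^esub> u)"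
  using star_pair.sup_S_L1[OF swap assms] unfolding lattice_star_commute[of z t L2 L1] .

lemma inf_S_L2:
  assumes "x \<in> carrier L2" "x \<noteq> \<top>\<^bsub>L2\<^esub>" "y \<in> carrier L2"
  shows "\<exists>s\<in>carrier S. s \<sqsubseteq>\<^bsub>S\<^esub> x \<and> s \<sqsubseteq>\<^bsub>S\<^esub> y \<and>
    (\<forall>u\<in>carrier S. u \<sqsubseteq>\<^bsub>S\<^esub> x \<longrightarrow> u \<sqsubseteq>\<^bsub>S\<^esub> y \<longrightarrow> u \<sqsubseteq>\<^bsub>S\<^esub> s)"
  using star_pair.inf_S_L1[OF swap assms] unfolding lattice_star_commute[of z t L2 L1] .

lemma sup_S_mixed:
  assumes "x \<in> carrier L1" "y \<in> carrier L2" "x \<sqsubseteq>\<^bsub>S\<^esub> u" "y \<sqsubseteq>\<^bsub>S\<^esub> u"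
  shows "u = t"
  using assms le_S_L1 le_S_L2 disjoint by blast

lemma inf_S_mixed:
  assumes "x \<in> carrier L1" "y \<in> carrier L2" "u \<sqsubseteq>\<^bsub>S\<^esub> x" "u \<sqsubseteq>\<^bsub>S\<^esub> y"
  shows "u = z"
  using assms t_new disjoint unfolding le_S by blast

lemma sup_S:
  assumes x: "x \<in> carrier S" and y: "y \<in> carrier S"
  shows "\<exists>s\<in>carrier S. x \<sqsubseteq>\<^bsub>S\<^esub> s \<and> y \<sqsubseteq>\<^bsub>S\<^esub> s \<and>
    (\<forall>u\<in>carrier S. x \<sqsubseteq>\<^bsub>S\<^esub> u \<longrightarrow> y \<sqsubseteq>\<^bsub>S\<^esub> u \<longrightarrow> s \<sqsubseteq>\<^bsub>S\<^esub> u)"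
proof -
  interpret partial_order S by (rule partial_order_S)
  have t: "t \<in> carrier S" unfolding carrier_S by simp
  have comparable: ?thesis if "x \<sqsubseteq>\<^bsub>S\<^esub> y \<or> y \<sqsubseteq>\<^bsub>S\<^esub> x" using that x y le_refl by blast
  have mixed: ?thesis if "\<And>u. x \<sqsubseteq>\<^bsub>S\<^esub> u \<Longrightarrow> y \<sqsubseteq>\<^bsub>S\<^esub> u \<Longrightarrow> u = t"
    using that t bounds_S by metis
  show ?thesis
    using x
  proof (cases rule: S_cases)
    case 3
    note x = this
    from y show ?thesis
    proof (cases rule: S_cases)
      case 3
      then show ?thesis using x sup_S_L1 by blast
    next
      case 4
      then show ?thesis using x mixed sup_S_mixed by blast
    qed (use comparable bounds_S in blast)+
  next
    case 4
    note x = this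
    from y show ?thesis
    proof (cases rule: S_cases)
      case 3
      then show ?thesis using x mixed sup_S_mixed by blast
    next
      case 4
      then show ?thesis using x sup_S_L2 by blast
    qed (use comparable bounds_S in blast)+
  qed (use comparable bounds_S in blast)+
qed

lemma inf_S:
  assumes x: "x \<in> carrier S" and y: "y \<in> carrier S"
  shows "\<exists>s\<in>carrier S. s \<sqsubseteq>\<^bsub>S\<^esub> x \<and> s \<sqsubseteq>\<^bsub>S\<^esub> y \<and>
    (\<forall>u\<in>carrier S. u \<sqsubseteq>\<^bsub>S\<^esub> x \<longrightarrow> u \<sqsubseteq>\<^bsub>S\<^esub> y \<longrightarrow> u \<sqsubseteq>\<^bsub>S\<^esub> s)"
proof -
  interpret partial_order S by (rule partial_order_S)
  have z: "z \<in> carrier S" unfolding carrier_S by simp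
  have comparable: ?thesis if "x \<sqsubseteq>\<^bsub>S\<^esub> y \<or> y \<sqsubseteq>\<^bsub>S\<^esub> x" using that x y le_refl by blast
  have mixed: ?thesis if "\<And>u. u \<sqsubseteq>\<^bsub>S\<^esub> x \<Longrightarrow> u \<sqsubseteq>\<^bsub>S\<^esub> y \<Longrightarrow> u = z"
    using that z bounds_S by metis
  show ?thesis
    using x
  proof (cases rule: S_cases)
    case 3
    note x = this
    from y show ?thesis
    proof (cases rule: S_cases)
      case 3
      then show ?thesis using x inf_S_L1 by blast
    next
      case 4
      then show ?thesis using x mixed inf_S_mixed by blast
    qed (use comparable bounds_S in blast)+
  next
    case 4
    note x = this
    from y show ?thesis
    proof (cases rule: S_cases)
      case 3
      then show ?thesis using x mixed inf_S_mixed by blast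
    next
      case 4
      then show ?thesis using x inf_S_L2 by blast
    qed (use comparable bounds_S in blast)+
  qed (use comparable bounds_S in blast)+
qed

lemma finite_lattice_S: "finite_lattice S"
proof -
  interpret partial_order S by (rule partial_order_S)
  have "\<exists>s. least S s (Upper S {x, y})" if "x \<in> carrier S" "y \<in> carrier S" for x y
    using sup_S[OF that] that unfolding least_def Upper_def by auto
  moreover have "\<exists>s. greatest S s (Lower S {x, y})" if "x \<in> carrier S" "y \<in> carrier S" for x y
    using inf_S[OF that] that unfolding greatest_def Lower_def by auto
  ultimately have "lattice S" by unfold_locales auto
  moreover have "finite (carrier S)" using L1 L2 unfolding carrier_S finite_lattice_def by simp
  moreover have "carrier S \<noteq> {}" unfolding carrier_S by simp
  ultimately show ?thesis unfolding finite_lattice_def by blast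
qed

text \<open>The least element of the copy of \<open>L1\<close> in \<open>L1 * L2\<close>, with \<open>t\<close> in the role of the greatest
  element of \<open>L1\<close>. If \<open>L1\<close> is trivial, then the copy consists of \<open>t\<close> alone.\<close>

definition copy_bot :: 'a where
  "copy_bot = (if \<bottom>\<^bsub>L1\<^esub> = \<top>\<^bsub>L1\<^esub> then t else \<bottom>\<^bsub>L1\<^esub>)"

lemma copy_bot_in: "copy_bot \<in> carrier S"
  unfolding copy_bot_def carrier_S using finite_lattice_bottom(1)[OF L1] by auto

lemma copy_bot_le_iff:
  assumes "s \<in> carrier S"
  shows "copy_bot \<sqsubseteq>\<^bsub>S\<^esub> s \<longleftrightarrow> s = t \<or> s \<in> carrier L1"
proof -
  interpret A: lattice L1 by (rule lattices)
  note bot = finite_lattice_bottom[OF L1] and top = finite_lattice_top[OF L1]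
  show ?thesis
  proof (cases "\<bottom>\<^bsub>L1\<^esub> = \<top>\<^bsub>L1\<^esub>")
    case True
    then have "x = \<top>\<^bsub>L1\<^esub>" if "x \<in> carrier L1" for x
      using bot top that A.le_antisym by metis
    then have "s \<notin> carrier L1" using assms z_new t_new disjoint unfolding carrier_S by blast
    then show ?thesis using True le_S_t unfolding copy_bot_def by simp
  next
    case False
    then show ?thesis unfolding copy_bot_def using le_S_L1[OF bot(1)] bot(2) by auto
  qed
qed

text \<open>The up-set of \<open>copy_bot\<close> is \<open>L1\<close> with its top replaced by
  \<open>t\<close>, and \<open>g\<close> undoes the replacement.\<close>

lemma upset_iso:
  defines "g \<equiv> \<lambda>s. if s = t then \<top>\<^bsub>L1\<^esub> else s"
  shows "bij_betw g {s \<in> carrier S. copy_bot \<sqsubseteq>\<^bsub>S\<^esub> s} (carrier L1)"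
    and "\<And>s s'. \<lbrakk>s \<in> carrier S; copy_bot \<sqsubseteq>\<^bsub>S\<^esub> s; s' \<in> carrier S; copy_bot \<sqsubseteq>\<^bsub>S\<^esub> s'\<rbrakk>
      \<Longrightarrow> g s \<sqsubseteq>\<^bsub>L1\<^esub> g s' \<longleftrightarrow> s \<sqsubseteq>\<^bsub>S\<^esub> s'"
proof -
  interpret A: lattice L1 by (rule lattices)
  note top = finite_lattice_top[OF L1]
  have upset: "{s \<in> carrier S. copy_bot \<sqsubseteq>\<^bsub>S\<^esub> s} = insert t (carrier L1 - {\<top>\<^bsub>L1\<^esub>})"
    using copy_bot_le_iff z_new disjoint unfolding carrier_S by auto
  show "bij_betw g {s \<in> carrier S. copy_bot \<sqsubseteq>\<^bsub>S\<^esub> s} (carrier L1)"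
    unfolding upset g_def bij_betw_def inj_on_def using t_new top(1) by auto
  have top_le: "\<top>\<^bsub>L1\<^esub> \<sqsubseteq>\<^bsub>L1\<^esub> x \<longleftrightarrow> x = \<top>\<^bsub>L1\<^esub>" if "x \<in> carrier L1" for x
    using top that A.le_antisym by blast
  show "g s \<sqsubseteq>\<^bsub>L1\<^esub> g s' \<longleftrightarrow> s \<sqsubseteq>\<^bsub>S\<^esub> s'"
    if s: "s \<in> carrier S" "copy_bot \<sqsubseteq>\<^bsub>S\<^esub> s" "s' \<in> carrier S" "copy_bot \<sqsubseteq>\<^bsub>S\<^esub> s'" for s s'
  proof -
    have "s = t \<or> s \<in> carrier L1 \<and> s \<noteq> \<top>\<^bsub>L1\<^esub>" "s' = t \<or> s' \<in> carrier L1 \<and> s' \<noteq> \<top>\<^bsub>L1\<^esub>"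
      using s upset by blast+
    then show ?thesis unfolding g_def using le_S_t le_S_L1 top top_le t_new by auto
  qed
qed

lemma transversal_contract_upset:
  fixes E :: "nat set"
  assumes "Tr_lattice L1" and M: "matroid E indep"
    and h: "order_emb (cyclic_flats E indep) S h" "bij_betw h {X. cyclic_flat E indep X} (carrier S)"
    and B: "cyclic_flat E indep B" "h B = copy_bot"
  shows "transversal_matroid (E - B) (matroid.contract E indep B)"
proof -
  interpret matroid E indep by (rule M)
  interpret A: lattice L1 by (rule lattices)
  have "order_isomorphic (cyclic_flats (E - B) (contract B)) L1"
    using order_isomorphic_contract[OF B(1) h A.weak_partial_order_axioms] upset_iso unfolding B(2)
    by blast
  moreover have "matroid (E - B) (contract B)" using cyclic_flatD(1)[OF B(1)] by (rule matroid_contract)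
  ultimately show ?thesis using assms(1) unfolding Tr_lattice_def by blast
qed

end

theorem theorem5p4:
  fixes L1 L2 :: "'a gorder" and z t :: 'a
  assumes "Tr_lattice L1" and "Tr_lattice L2"
    and "carrier L1 \<inter> carrier L2 = {}"
    and "z \<noteq> t"
    and "z \<notin> carrier L1 \<union> carrier L2" and "t \<notin> carrier L1 \<union> carrier L2"
  shows "Tr_lattice (lattice_star z t L1 L2)"
proof -
  interpret P: star_pair L1 L2 z t
    using assms unfolding Tr_lattice_def by unfold_locales auto
  interpret Q: star_pair L2 L1 z t by (rule P.swap)
  have QS: "Q.S = P.S" by (rule lattice_star_commute)
  have "transversal_matroid E indep"
    if M: "matroid E indep" and iso: "order_isomorphic (cyclic_flats E indep) P.S"
    for E :: "nat set" and indep
  proof -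
    interpret matroid E indep by (rule M)
    obtain h where h: "order_emb (cyclic_flats E indep) P.S h"
      "bij_betw h {X. cyclic_flat E indep X} (carrier P.S)"
      using iso unfolding order_isomorphic_def cyclic_flats_def by auto
    have h_le: "X \<subseteq> Y \<longleftrightarrow> h X \<sqsubseteq>\<^bsub>P.S\<^esub> h Y" if "cyclic_flat E indep X" "cyclic_flat E indep Y" for X Y
      using h(1) that unfolding order_emb_def cyclic_flats_def by simp
    have h_in: "h X \<in> carrier P.S" if "cyclic_flat E indep X" for X
      using h(2) that by (auto dest: bij_betwE)
    have preimage: "\<exists>X. cyclic_flat E indep X \<and> h X = s" if "s \<in> carrier P.S" for s
    proof -
      have "s \<in> h ` {X. cyclic_flat E indep X}" using h(2) that by (simp add: bij_betw_def)
      then show ?thesis by auto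
    qed
    obtain b1 where b1: "cyclic_flat E indep b1" "h b1 = P.copy_bot" using preimage P.copy_bot_in by blast
    obtain b2 where b2: "cyclic_flat E indep b2" "h b2 = Q.copy_bot"
      using preimage Q.copy_bot_in unfolding QS by blast
    obtain T where T: "cyclic_flat E indep T" "h T = t" using preimage P.carrier_S by blast
    have top: "F \<subseteq> T" if "cyclic_flat E indep F" for F
      using h_le[OF that T(1)] T(2) P.le_S by simp
    have b1_le: "b1 \<subseteq> F \<longleftrightarrow> h F = t \<or> h F \<in> carrier L1" if "cyclic_flat E indep F" for F
      using h_le[OF b1(1) that] b1(2) P.copy_bot_le_iff[OF h_in[OF that]] by simp
    have b2_le: "b2 \<subseteq> F \<longleftrightarrow> h F = t \<or> h F \<in> carrier L2" if "cyclic_flat E indep F" for F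
      using h_le[OF b2(1) that] b2(2) Q.copy_bot_le_iff h_in[OF that] unfolding QS by simp
    have loops: "cyclic_flat E indep (cl {})" by (rule cyclic_flat_cl) (auto simp: cyclic_def)
    show ?thesis
    proof (rule transversal_of_contractions[OF T(1) b1(1) top[OF b1(1)] b2(1) top[OF b2(1)] top])
      fix F assume F: "cyclic_flat E indep F"
      show "F = cl {} \<or> b1 \<subseteq> F \<or> b2 \<subseteq> F"
        using h_in[OF F]
      proof (cases rule: P.S_cases)
        case 1
        then have "F \<subseteq> cl {}" using h_le[OF F loops] P.le_S by simp
        moreover have "cl {} \<subseteq> F"
          using rank_insert_eq_mono[of "{}" F] cyclic_flatD(2)[OF F] unfolding cl_def by blast
        ultimately show ?thesis by blast
      qed (use b1_le[OF F] b2_le[OF F] in auto)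
    next
      \<comment> \<open>\<open>G\<close> is a cyclic flat above both \<open>b1\<close> and
        \<open>b2\<close>. Unless its image is \<open>t\<close>, that image lies in both disjoint
        carriers; hence \<open>G = T\<close>.\<close>
      define G where "G = cl (b1 \<union> b2)"
      have sub: "b1 \<union> b2 \<subseteq> E" using cyclic_flatD(1) b1(1) b2(1) by blast
      have G: "cyclic_flat E indep G"
        unfolding G_def using sub cyclic_Un cyclic_flatD(3) b1(1) b2(1) by (intro cyclic_flat_cl) auto
      have "b1 \<subseteq> G" "b2 \<subseteq> G" using subset_cl[OF sub] unfolding G_def by auto
      then have "h G = t" using b1_le[OF G] b2_le[OF G] assms(3) by blast
      then have "G = T" using h(2) G T unfolding bij_betw_def inj_on_def by auto
      then show "rank (b1 \<union> b2) = rank T" using rank_cl[OF sub] unfolding G_def by simp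
    next
      show "transversal_matroid (E - b1) (contract b1)"
        using P.transversal_contract_upset[OF assms(1) M h b1] .
      show "transversal_matroid (E - b2) (contract b2)"
        using Q.transversal_contract_upset[OF assms(2) M, unfolded QS, OF h b2] .
    qed
  qed
  then show ?thesis unfolding Tr_lattice_def using P.finite_lattice_S by blast
qed

end
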